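(* Let $W$ be a finite Coxeter group. For all finite positive integers $k$ and $\ell$ there are isomorphisms of posets $$(NC^{(k)}(W))^{(\ell)}\cong NC^{(k\ell)}(W)\cong(NC^{(\ell)}(W))^{(k)}.$$
   Context: Let $(W,S)$ be a finite Coxeter system, $T=\{wsw^{-1}:s\in S,w\in W\}$ its set of reflections, $\ell_T$ the word length on $W$ with respect to $T$, and $\pi\leq_T\mu \iff \ell_T(\mu)=\ell_T(\pi)+\ell_T(\pi^{-1}\mu)$ the absolute order. A Coxeter element is any $W$-conjugate of a product of all elements of $S$ in some order; fix one, $c$, and put $NC(W)=\{w\in W:1\leq_T w\leq_T c\}$. $NC^{(k)}(W)$ is the set of $k$-multichains $(\pi)_k=(\pi_1,\ldots,\pi_k)$, $\pi_1\leq_T\cdots\leq_T\pi_k$ in $NC(W)$, with $(\pi)_k\leq(\mu)_k$ iff $\mu_i^{-1}\mu_{i+1}\leq_T\pi_i^{-1}\pi_{i+1}$ for all $1\leq i\leq k$, where $\pi_{k+1}=\mu_{k+1}=c$. Iterated construction. The $k$-fold product $W^k$ is a finite Coxeter group (generators: a simple generator of $W$ in one coordinate and $1$ elsewhere), and with respect to its Coxeter element $(c,\ldots,c)$, $NC(W^k)=NC(W)^k$ with the componentwise order. Let $K$ be the anti-automorphism $K(w)=w^{-1}(c,\ldots,c)$ of $NC(W^k)$; an odd power $\Psi$ of $K$ is called a Kreweras-type anti-automorphism. Let $\partial(\pi)_k=(\pi_1^{-1}\pi_2,\ldots,\pi_{k-1}^{-1}\pi_k,\pi_k^{-1}c)$.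 Then $\Psi\circ\partial$ embeds $NC^{(k)}(W)$ as an induced subposet $NC^{(k)}_\Psi(W)$ of $NC(W^k)$. The poset $(NC^{(k)}(W))^{(\ell)}$ is defined as the induced subposet of $NC^{(\ell)}(W^k)$ consisting of the $\ell$-multichains in $NC(W^k)$ all of whose entries lie in $NC^{(k)}_\Psi(W)$, for a fixed choice of Kreweras-type $\Psi$; it is independent of the choice of $\Psi$ up to isomorphism. *)

theory Defs
  imports "HOL-Algebra.Algebra"
begin

section \<open>Coxeter systems\<close>

definition word_val :: "('a, 'm) monoid_scheme \<Rightarrow> 'a list \<Rightarrow> 'a" where
  "word_val G ws = foldr (\<otimes>\<^bsub>G\<^esub>) ws \<one>\<^bsub>G\<^esub>"

text \<open>
  One application of a defining relator \<open>(s t)^m(s,t)\<close>, where \<open>m(s,t)\<close> is the order of \<open>s t\<close>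
  in the group; \<open>group.ord\<close> is \<open>0\<close> for infinite order, which gives the empty relator. The case
  \<open>s = t\<close> gives the relator \<open>s s\<close>, so that every generator is its own formal inverse and the monoid
  presented by these relators is the group presented by them.
\<close>

inductive coxeter_step :: "('a, 'm) monoid_scheme \<Rightarrow> 'a set \<Rightarrow> 'a list \<Rightarrow> 'a list \<Rightarrow> bool"
  for G :: "('a, 'm) monoid_scheme" and S :: "'a set" where
  "\<lbrakk>s \<in> S; t \<in> S; us \<in> lists S; vs \<in> lists S\<rbrakk> \<Longrightarrow>
     coxeter_step G S (us @ concat (replicate (group.ord G (s \<otimes>\<^bsub>G\<^esub> t)) [s, t]) @ vs) (us @ vs)"

definition coxeter_system :: "('a, 'm) monoid_scheme \<Rightarrow> 'a set \<Rightarrow> bool" where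
  "coxeter_system G S \<longleftrightarrow>
     group G \<and> S \<subseteq> carrier G \<and> generate G S = carrier G \<and>
     (\<forall>s\<in>S. group.ord G s = 2) \<and>
     (\<forall>us\<in>lists S. \<forall>vs\<in>lists S.
        word_val G us = word_val G vs \<longleftrightarrow> equivclp (coxeter_step G S) us vs)"

definition finite_coxeter_system :: "('a, 'm) monoid_scheme \<Rightarrow> 'a set \<Rightarrow> bool" where
  "finite_coxeter_system G S \<longleftrightarrow> coxeter_system G S \<and> finite (carrier G)"

definition coxeter_element :: "('a, 'm) monoid_scheme \<Rightarrow> 'a set \<Rightarrow> 'a \<Rightarrow> bool" where
  "coxeter_element G S c \<longleftrightarrow>
     (\<exists>ss. \<exists>w\<in>carrier G. distinct ss \<and> set ss = S \<and>
        c = w \<otimes>\<^bsub>G\<^esub> word_val G ss \<otimes>\<^bsub>G\<^esub> inv\<^bsub>G\<^esub> w)"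


section \<open>Absolute order and noncrossing partitions\<close>

definition reflections :: "('a, 'm) monoid_scheme \<Rightarrow> 'a set \<Rightarrow> 'a set" where
  "reflections G S = {w \<otimes>\<^bsub>G\<^esub> s \<otimes>\<^bsub>G\<^esub> inv\<^bsub>G\<^esub> w | s w. s \<in> S \<and> w \<in> carrier G}"

definition abs_length :: "('a, 'm) monoid_scheme \<Rightarrow> 'a set \<Rightarrow> 'a \<Rightarrow> nat" where
  "abs_length G S w =
     (LEAST n. \<exists>ts \<in> lists (reflections G S). length ts = n \<and> word_val G ts = w)"

definition abs_le :: "('a, 'm) monoid_scheme \<Rightarrow> 'a set \<Rightarrow> 'a \<Rightarrow> 'a \<Rightarrow> bool" where
  "abs_le G S u v \<longleftrightarrow>
     abs_length G S v = abs_length G S u + abs_length G S (inv\<^bsub>G\<^esub> u \<otimes>\<^bsub>G\<^esub> v)"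

definition NC :: "('a, 'm) monoid_scheme \<Rightarrow> 'a set \<Rightarrow> 'a \<Rightarrow> 'a set" where
  "NC G S c = {w \<in> carrier G. abs_le G S \<one>\<^bsub>G\<^esub> w \<and> abs_le G S w c}"

text \<open>
  Tuples \<open>(x\<^sub>1, \<dots>, x\<^sub>k)\<close> are extensional functions on \<open>{1..k}\<close>, as in \<^const>\<open>product_group\<close>. The
  update \<open>p(Suc k := c)\<close> below is the convention that the entry with index \<open>k + 1\<close> is \<open>c\<close>.
\<close>

definition delta :: "('a, 'm) monoid_scheme \<Rightarrow> 'a \<Rightarrow> nat \<Rightarrow> (nat \<Rightarrow> 'a) \<Rightarrow> (nat \<Rightarrow> 'a)" where
  "delta G c k p = (\<lambda>i\<in>{1..k}. inv\<^bsub>G\<^esub> (p i) \<otimes>\<^bsub>G\<^esub> (p(Suc k := c)) (Suc i))"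

definition NC_multichains ::
  "('a, 'm) monoid_scheme \<Rightarrow> 'a set \<Rightarrow> 'a \<Rightarrow> nat \<Rightarrow> (nat \<Rightarrow> 'a) set" where
  "NC_multichains G S c k =
     {p \<in> {1..k} \<rightarrow>\<^sub>E NC G S c. \<forall>i. 1 \<le> i \<and> i < k \<longrightarrow> abs_le G S (p i) (p (Suc i))}"

definition NCk :: "('a, 'm) monoid_scheme \<Rightarrow> 'a set \<Rightarrow> 'a \<Rightarrow> nat \<Rightarrow> (nat \<Rightarrow> 'a) gorder" where
  "NCk G S c k =
     \<lparr>carrier = NC_multichains G S c k, eq = (=),
      le = (\<lambda>p q. \<forall>i\<in>{1..k}. abs_le G S (delta G c k q i) (delta G c k p i))\<rparr>"


section \<open>The iterated construction\<close>

abbreviation power_group :: "('a, 'm) monoid_scheme \<Rightarrow> nat \<Rightarrow> (nat \<Rightarrow> 'a) monoid" where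
  "power_group G k \<equiv> product_group {1..k} (\<lambda>_. G)"

definition power_gens :: "('a, 'm) monoid_scheme \<Rightarrow> 'a set \<Rightarrow> nat \<Rightarrow> (nat \<Rightarrow> 'a) set" where
  "power_gens G S k =
     {f \<in> carrier (power_group G k). \<exists>i\<in>{1..k}. f i \<in> S \<and> (\<forall>j\<in>{1..k} - {i}. f j = \<one>\<^bsub>G\<^esub>)}"

definition power_elt :: "'a \<Rightarrow> nat \<Rightarrow> (nat \<Rightarrow> 'a)" where
  "power_elt c k = (\<lambda>i\<in>{1..k}. c)"

definition kreweras :: "('a, 'm) monoid_scheme \<Rightarrow> 'a \<Rightarrow> 'a \<Rightarrow> 'a" where
  "kreweras G c w = inv\<^bsub>G\<^esub> w \<otimes>\<^bsub>G\<^esub> c"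

text \<open>Odd powers, both positive and negative, of the bijection \<open>K\<close> of \<^const>\<open>NC\<close>.\<close>

definition kreweras_type :: "('a, 'm) monoid_scheme \<Rightarrow> 'a set \<Rightarrow> 'a \<Rightarrow> ('a \<Rightarrow> 'a) \<Rightarrow> bool" where
  "kreweras_type G S c \<Psi> \<longleftrightarrow>
     (\<exists>n. odd n \<and> (\<Psi> = kreweras G c ^^ n \<or>
                   \<Psi> = inv_into (NC G S c) (kreweras G c) ^^ n))"

definition NCk_image ::
  "('a, 'm) monoid_scheme \<Rightarrow> 'a set \<Rightarrow> 'a \<Rightarrow> nat \<Rightarrow> ((nat \<Rightarrow> 'a) \<Rightarrow> (nat \<Rightarrow> 'a)) \<Rightarrow> (nat \<Rightarrow> 'a) set"
  where "NCk_image G S c k \<Psi> = (\<Psi> \<circ> delta G c k) ` carrier (NCk G S c k)"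

text \<open>\<open>NCk_iter G S c k \<Psi> l\<close> is the poset \<open>(NC\<^sup>(\<^sup>k\<^sup>)(W))\<^sup>(\<^sup>l\<^sup>)\<close>, formed with the map \<open>\<Psi>\<close>.\<close>

definition NCk_iter ::
  "('a, 'm) monoid_scheme \<Rightarrow> 'a set \<Rightarrow> 'a \<Rightarrow> nat \<Rightarrow> ((nat \<Rightarrow> 'a) \<Rightarrow> (nat \<Rightarrow> 'a)) \<Rightarrow> nat
     \<Rightarrow> (nat \<Rightarrow> nat \<Rightarrow> 'a) gorder" where
  "NCk_iter G S c k \<Psi> l =
     (let P = NCk (power_group G k) (power_gens G S k) (power_elt c k) l
      in P\<lparr>carrier := {p \<in> carrier P. \<forall>i\<in>{1..l}. p i \<in> NCk_image G S c k \<Psi>}\<rparr>)"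

definition poset_iso :: "('a, 'm) gorder_scheme \<Rightarrow> ('b, 'n) gorder_scheme \<Rightarrow> bool" where
  "poset_iso P Q \<longleftrightarrow>
     (\<exists>f. bij_betw f (carrier P) (carrier Q) \<and>
          (\<forall>x\<in>carrier P. \<forall>y\<in>carrier P. x \<sqsubseteq>\<^bsub>P\<^esub> y \<longleftrightarrow> f x \<sqsubseteq>\<^bsub>Q\<^esub> f y))"

end

theory Submission
  imports Defs "HOL-Library.Sublist"
begin

text \<open>
  The map \<^const>\<open>delta\<close> turns a multichain \<open>\<pi>\<^sub>1 \<le> \<dots> \<le> \<pi>\<^sub>n \<le> c\<close> into a tuple \<open>d\<^sub>1, \<dots>, d\<^sub>n\<close> whose product
  lies below \<open>c\<close> and on which the reflection length is additive; conversely such a tuple determines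
  the multichain by \<open>\<pi>\<^sub>i = c (d\<^sub>i \<dots> d\<^sub>n)\<^sup>-\<^sup>1\<close>. These are the tuples in \<open>factor_tuples c n\<close>, and the order of
  \<open>NC\<^sup>(\<^sup>n\<^sup>)(W)\<close> is the reverse of the componentwise absolute order on them (\<open>bij_betw_delta\<close>).

  A Kreweras-type map has the form \<open>\<Psi> w = g w\<^sup>-\<^sup>1 g\<^sup>-\<^sup>1 c\<close> with \<open>g\<close> commuting with \<open>c\<close>
  (\<open>kreweras_type_conjugation\<close>). So an element of the iterated poset is a multichain with
  entries \<open>p\<^sub>i = \<Psi> D\<^sub>i\<close>, where each \<open>D\<^sub>i\<close> is a tuple of \<open>k\<close> factors. The differences \<open>E\<^sub>i\<close> of this multichain in \<open>W\<^sup>k\<close>,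
  conjugated by an element \<open>u\<close> that commutes with \<open>c\<close>, form an \<open>l \<times> k\<close> matrix \<open>x i j\<close> in which
  \<open>D\<^sub>i\<close> collects, for each column \<open>j\<close>, the product \<open>x i j \<dots> x l j\<close>. Reading this matrix column by column yields
  a single tuple of \<open>k l\<close> factors. The point of the proof is that this tuple is in
  \<open>factor_tuples c (k * l)\<close> exactly when every column is reduced below \<open>c\<close> and every \<open>D\<^sub>i\<close> is in
  \<open>factor_tuples c k\<close> (\<open>reduced_below_matrix_iff\<close>): a concatenation is reduced iff its blocks and
  the list of block products are, and a subword of a factorization below \<open>c\<close> is again one
  (\<open>reduced_below_subseq\<close>), so that all \<open>D\<^sub>i\<close> are controlled by \<open>D\<^sub>1\<close>. Conjugation preserves
  the absolute order, and the order on \<open>W\<^sup>k\<close> is componentwise because length on \<open>W\<^sup>k\<close> is the sum of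
  the lengths of the coordinates (\<open>len_power\<close>). Hence the iterated poset and \<open>NC\<^sup>(\<^sup>k\<^sup>l\<^sup>)(W)\<close> are both isomorphic to
  the same set of tuples with the same order. Exchanging \<open>k\<close> and \<open>l\<close> gives the second isomorphism.

  Multichains, differences and Kreweras-type maps occur both for \<open>W\<close> and for \<open>W\<^sup>k\<close>, so their theory is
  developed in a locale, \<open>reflection_generated\<close>, of which both groups are instances.
\<close>

(* Intervals are kept as {1..n} and [1..<Suc n], the shape in which the index sets of tuples occur. *)
declare upt_Suc [simp del] One_nat_def [simp del]

section \<open>Length with respect to reflections\<close>

lemma word_val_simps [simp]:
  "word_val G [] = \<one>\<^bsub>G\<^esub>"
  "word_val G (x # xs) = x \<otimes>\<^bsub>G\<^esub> word_val G xs"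
  by (simp_all add: word_val_def)

lemma (in group) inv_cancel_left [simp]:
  assumes "x \<in> carrier G" and "y \<in> carrier G"
  shows "x \<otimes> (inv x \<otimes> y) = y" and "inv x \<otimes> (x \<otimes> y) = y"
  using assms by (simp_all flip: m_assoc)

lemma (in group) word_val_closed [simp]:
  "set xs \<subseteq> carrier G \<Longrightarrow> word_val G xs \<in> carrier G"
  by (induct xs) auto

lemma (in group) word_val_append:
  "set xs \<subseteq> carrier G \<Longrightarrow> set ys \<subseteq> carrier G \<Longrightarrow>
     word_val G (xs @ ys) = word_val G xs \<otimes> word_val G ys"
  by (induct xs) (auto simp: m_assoc)

lemma (in group) word_val_concat:
  "(\<And>xs. xs \<in> set xss \<Longrightarrow> set xs \<subseteq> carrier G) \<Longrightarrow>
     word_val G (concat xss) = word_val G (map (word_val G) xss)"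
  by (induct xss) (auto simp: word_val_append UN_subset_iff)

lemma (in group) word_val_conj:
  assumes "h \<in> carrier G"
  shows "set xs \<subseteq> carrier G \<Longrightarrow>
     word_val G (map (\<lambda>x. h \<otimes> x \<otimes> inv h) xs) = h \<otimes> word_val G xs \<otimes> inv h"
  using assms by (induct xs) (auto simp: m_assoc)

lemma subseq_concat_map:
  "(\<And>x. x \<in> set xs \<Longrightarrow> subseq (f x) (g x)) \<Longrightarrow> subseq (concat (map f xs)) (concat (map g xs))"
  by (induct xs) (auto intro: list_emb_append_mono)

lemma subseq_concat: "xs \<in> set xss \<Longrightarrow> subseq xs (concat xss)"
  by (induct xss) (auto intro: subseq_drop_many subseq_rev_drop_many)

text \<open>
  Generation is phrased by words in reflections instead of words in \<open>S\<close>, because that is what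
  the length needs and what can be shown directly, together with the length formula, for powers of the group.
\<close>

locale reflection_generated = group G
  for G :: "('a, 'm) monoid_scheme" (structure) +
  fixes S :: "'a set"
  assumes gens_closed: "S \<subseteq> carrier G"
    and reflection_word: "w \<in> carrier G \<Longrightarrow> \<exists>ts\<in>lists (reflections G S). word_val G ts = w"
begin

abbreviation len :: "'a \<Rightarrow> nat" where
  "len \<equiv> abs_length G S"

abbreviation le_T :: "'a \<Rightarrow> 'a \<Rightarrow> bool"  (infix \<open>\<preceq>\<close> 50) where
  "u \<preceq> v \<equiv> abs_le G S u v"

lemma reflections_closed: "reflections G S \<subseteq> carrier G"
  using gens_closed by (auto simp: reflections_def)

lemma reflections_conj:
  assumes t: "t \<in> reflections G S" and h: "h \<in> carrier G"
  shows "h \<otimes> t \<otimes> inv h \<in> reflections G S"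
proof -
  obtain s w where s: "s \<in> S" and w: "w \<in> carrier G" and t: "t = w \<otimes> s \<otimes> inv w"
    using t by (auto simp: reflections_def)
  have "s \<in> carrier G" using s gens_closed by auto
  then have "h \<otimes> t \<otimes> inv h = (h \<otimes> w) \<otimes> s \<otimes> inv (h \<otimes> w)"
    using w h t by (simp add: m_assoc inv_mult_group)
  then show ?thesis using s w h by (auto simp: reflections_def)
qed

lemma len_le: "ts \<in> lists (reflections G S) \<Longrightarrow> len (word_val G ts) \<le> length ts"
  unfolding abs_length_def by (rule Least_le) auto

lemma len_word:
  assumes "w \<in> carrier G"
  obtains ts where "ts \<in> lists (reflections G S)" "length ts = len w" "word_val G ts = w"
proof -
  have "\<exists>n. \<exists>ts\<in>lists (reflections G S). length ts = n \<and> word_val G ts = w"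
    using reflection_word[OF assms] by auto
  from LeastI_ex[OF this] that show ?thesis
    by (auto simp: abs_length_def)
qed

lemma len_one [simp]: "len \<one> = 0"
  using len_le[of "[]"] by simp

lemma len_mult:
  assumes "x \<in> carrier G" "y \<in> carrier G"
  shows "len (x \<otimes> y) \<le> len x + len y"
proof -
  obtain xs where xs: "xs \<in> lists (reflections G S)" "length xs = len x" "word_val G xs = x"
    using len_word[OF assms(1)] .
  obtain ys where ys: "ys \<in> lists (reflections G S)" "length ys = len y" "word_val G ys = y"
    using len_word[OF assms(2)] .
  have "set xs \<subseteq> carrier G" "set ys \<subseteq> carrier G"
    using xs(1) ys(1) reflections_closed by auto
  then have "word_val G (xs @ ys) = x \<otimes> y"
    using xs ys by (simp add: word_val_append)
  then show ?thesis
    using len_le[of "xs @ ys"] xs ys by auto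
qed

lemma len_conj_le:
  assumes "x \<in> carrier G" "h \<in> carrier G"
  shows "len (h \<otimes> x \<otimes> inv h) \<le> len x"
proof -
  obtain xs where xs: "xs \<in> lists (reflections G S)" "length xs = len x" "word_val G xs = x"
    using len_word[OF assms(1)] .
  have "set xs \<subseteq> carrier G"
    using xs(1) reflections_closed by auto
  then have "word_val G (map (\<lambda>x. h \<otimes> x \<otimes> inv h) xs) = h \<otimes> x \<otimes> inv h"
    using xs assms by (simp add: word_val_conj)
  moreover have "map (\<lambda>x. h \<otimes> x \<otimes> inv h) xs \<in> lists (reflections G S)"
    using xs(1) reflections_conj assms(2) by auto
  ultimately show ?thesis
    using len_le xs(2) by (metis length_map)
qed

lemma len_conj [simp]:
  assumes "x \<in> carrier G" "h \<in> carrier G"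
  shows "len (h \<otimes> x \<otimes> inv h) = len x"
proof (rule antisym)
  have "inv h \<otimes> (h \<otimes> x \<otimes> inv h) \<otimes> inv (inv h) = x"
    using assms by (simp add: m_assoc)
  then show "len x \<le> len (h \<otimes> x \<otimes> inv h)"
    using len_conj_le[of "h \<otimes> x \<otimes> inv h" "inv h"] assms by simp
qed (use assms in \<open>rule len_conj_le\<close>)

lemma len_mult_swap:
  assumes "x \<in> carrier G" "y \<in> carrier G"
  shows "len (x \<otimes> y) = len (y \<otimes> x)"
  using len_conj[of "x \<otimes> y" y] assms by (simp add: m_assoc)

lemma len_0_iff [simp]: "w \<in> carrier G \<Longrightarrow> len w = 0 \<longleftrightarrow> w = \<one>"
  by (metis len_one len_word length_0_conv word_val_simps(1))


section \<open>Reduced factorizations below a fixed element\<close>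

lemma one_le: "w \<in> carrier G \<Longrightarrow> \<one> \<preceq> w"
  by (simp add: abs_le_def)

lemma NC_iff: "w \<in> NC G S c \<longleftrightarrow> w \<in> carrier G \<and> w \<preceq> c"
  by (auto simp: NC_def one_le)

lemma len_quotient_le:
  assumes "u \<in> carrier G" "v \<in> carrier G"
  shows "len v \<le> len u + len (inv u \<otimes> v)"
  using len_mult[of u "inv u \<otimes> v"] assms by simp

lemma le_trans:
  assumes "u \<preceq> v" "v \<preceq> w" and [simp]: "u \<in> carrier G" "v \<in> carrier G" "w \<in> carrier G"
  shows "u \<preceq> w"
proof -
  have "inv u \<otimes> w = (inv u \<otimes> v) \<otimes> (inv v \<otimes> w)"
    by (simp add: m_assoc)
  then have "len (inv u \<otimes> w) \<le> len (inv u \<otimes> v) + len (inv v \<otimes> w)"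
    using len_mult[of "inv u \<otimes> v" "inv v \<otimes> w"] by simp
  moreover have "len w \<le> len u + len (inv u \<otimes> w)"
    by (simp add: len_quotient_le)
  ultimately show ?thesis
    using assms(1,2) by (simp add: abs_le_def)
qed

lemma le_conj_iff:
  assumes [simp]: "u \<in> carrier G" "v \<in> carrier G" "h \<in> carrier G"
  shows "h \<otimes> u \<otimes> inv h \<preceq> h \<otimes> v \<otimes> inv h \<longleftrightarrow> u \<preceq> v"
proof -
  have "inv (h \<otimes> u \<otimes> inv h) \<otimes> (h \<otimes> v \<otimes> inv h) = h \<otimes> (inv u \<otimes> v) \<otimes> inv h"
    by (simp add: m_assoc inv_mult_group)
  then show ?thesis
    by (simp add: abs_le_def)
qed

text \<open>
  A list is reduced if its entries form a factorization without loss of length, and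
  reduced below \<open>c\<close> if it extends on the right, by one further factor, to such a factorization of \<open>c\<close>.
\<close>

definition reduced :: "'a list \<Rightarrow> bool" where
  "reduced xs \<longleftrightarrow> len (word_val G xs) = sum_list (map len xs)"

definition reduced_below :: "'a \<Rightarrow> 'a list \<Rightarrow> bool" where
  "reduced_below c xs \<longleftrightarrow> reduced xs \<and> word_val G xs \<preceq> c"

lemma reduced_Nil [simp]: "reduced []"
  by (simp add: reduced_def)

lemma reduced_single [simp]: "x \<in> carrier G \<Longrightarrow> reduced [x]"
  by (simp add: reduced_def)

lemma len_word_val: "set xs \<subseteq> carrier G \<Longrightarrow> len (word_val G xs) \<le> sum_list (map len xs)"
  by (induct xs) (auto intro: order_trans[OF len_mult])

lemma reduced_append_iff:
  assumes "set xs \<subseteq> carrier G" "set ys \<subseteq> carrier G"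
  shows "reduced (xs @ ys) \<longleftrightarrow> reduced xs \<and> reduced ys \<and>
    len (word_val G xs \<otimes> word_val G ys) = len (word_val G xs) + len (word_val G ys)"
  using len_word_val[OF assms(1)] len_word_val[OF assms(2)]
    len_mult[of "word_val G xs" "word_val G ys"] assms
  by (auto simp: reduced_def word_val_append)

text \<open>
  Subadditivity of the length makes additivity for the whole word equivalent to additivity
  inside each block together with additivity for the block products.
\<close>

lemma reduced_concat_iff:
  assumes "\<And>xs. xs \<in> set xss \<Longrightarrow> set xs \<subseteq> carrier G"
  shows "reduced (concat xss) \<longleftrightarrow>
    (\<forall>xs\<in>set xss. reduced xs) \<and> reduced (map (word_val G) xss)"
  using assms
proof (induct xss)
  case (Cons xs xss)
  have closed: "\<forall>xs\<in>set xss. set xs \<subseteq> carrier G"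
    using Cons.prems by simp
  then have sets: "set xs \<subseteq> carrier G" "set (concat xss) \<subseteq> carrier G"
    "set (map (word_val G) xss) \<subseteq> carrier G"
    using Cons.prems by auto
  have "reduced (map (word_val G) (xs # xss)) \<longleftrightarrow> reduced ([word_val G xs] @ map (word_val G) xss)"
    by simp
  also have "\<dots> \<longleftrightarrow> reduced (map (word_val G) xss) \<and>
      len (word_val G xs \<otimes> word_val G (concat xss)) = len (word_val G xs) + len (word_val G (concat xss))"
    using sets closed by (subst reduced_append_iff) (auto simp: word_val_concat)
  finally have vals: "reduced (map (word_val G) (xs # xss)) \<longleftrightarrow> \<dots>" .
  have "reduced (concat (xs # xss)) \<longleftrightarrow> reduced xs \<and> reduced (concat xss) \<and>
      len (word_val G xs \<otimes> word_val G (concat xss)) = len (word_val G xs) + len (word_val G (concat xss))"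
    unfolding concat.simps by (rule reduced_append_iff) (rule sets)+
  moreover have "reduced (concat xss) \<longleftrightarrow>
      (\<forall>xs\<in>set xss. reduced xs) \<and> reduced (map (word_val G) xss)"
    using Cons by simp
  ultimately show ?case
    unfolding vals by auto
qed simp

lemma reduced_conj_iff:
  assumes "h \<in> carrier G" "set xs \<subseteq> carrier G"
  shows "reduced (map (\<lambda>x. h \<otimes> x \<otimes> inv h) xs) \<longleftrightarrow> reduced xs"
proof -
  have "map len (map (\<lambda>x. h \<otimes> x \<otimes> inv h) xs) = map len xs"
    using assms by auto
  then show ?thesis
    using assms by (simp only: reduced_def word_val_conj) simp
qed

text \<open>
  A factor in the middle can be moved to the right end at the price of a conjugation,
  \<open>x a y = (x y) (y\<^sup>-\<^sup>1 a y)\<close>, and conjugation does not change its length. So \<open>x y\<close> lies below \<open>x a y\<close> and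
  has lost exactly the length of \<open>a\<close>.
\<close>

lemma reduced_below_drop:
  assumes "reduced_below c (xs @ a # ys)" and "c \<in> carrier G"
    and "set xs \<subseteq> carrier G" "a \<in> carrier G" "set ys \<subseteq> carrier G"
  shows "reduced_below c (xs @ ys)"
proof -
  define x where "x = word_val G xs"
  define y where "y = word_val G ys"
  have [simp]: "x \<in> carrier G" "y \<in> carrier G" "a \<in> carrier G" "c \<in> carrier G"
    using assms by (auto simp: x_def y_def)
  have val: "word_val G (xs @ a # ys) = x \<otimes> (a \<otimes> y)" "word_val G (xs @ ys) = x \<otimes> y"
    using assms by (simp_all add: word_val_append x_def y_def)
  have swap: "x \<otimes> (a \<otimes> y) = (x \<otimes> y) \<otimes> (inv y \<otimes> a \<otimes> y)"
    by (simp add: m_assoc)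
  have len_swap: "len (inv y \<otimes> a \<otimes> y) = len a"
    using len_conj[of a "inv y"] by simp
  have le: "len (x \<otimes> (a \<otimes> y)) \<le> len (x \<otimes> y) + len a"
    unfolding swap using len_mult[of "x \<otimes> y" "inv y \<otimes> a \<otimes> y"] len_swap by simp
  have full: "len (x \<otimes> (a \<otimes> y)) = sum_list (map len (xs @ ys)) + len a"
    using assms(1) val by (simp add: reduced_below_def reduced_def)
  have "len (x \<otimes> y) \<le> sum_list (map len (xs @ ys))"
    using len_word_val[of "xs @ ys"] assms val by simp
  then have eq: "len (x \<otimes> y) = sum_list (map len (xs @ ys))"
    using le full by simp
  have "inv (x \<otimes> y) \<otimes> (x \<otimes> (a \<otimes> y)) = inv y \<otimes> a \<otimes> y"
    by (simp add: swap)
  then have "x \<otimes> y \<preceq> x \<otimes> (a \<otimes> y)"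
    using eq full len_swap by (simp add: abs_le_def)
  moreover have "x \<otimes> (a \<otimes> y) \<preceq> c"
    using assms(1) val by (simp add: reduced_below_def)
  ultimately have "x \<otimes> y \<preceq> c"
    using le_trans by simp
  then show ?thesis
    using eq val by (simp add: reduced_below_def reduced_def)
qed

lemma reduced_below_subseq:
  assumes "subseq ys xs" and "reduced_below c xs" and "c \<in> carrier G" and "set xs \<subseteq> carrier G"
  shows "reduced_below c ys"
proof -
  \<comment> \<open>The prefix \<open>zs\<close> holds the part already processed, since being reduced depends on the whole list.\<close>
  have "reduced_below c (zs @ ys)"
    if "subseq ys xs" "reduced_below c (zs @ xs)" "set zs \<subseteq> carrier G" "set xs \<subseteq> carrier G"
    for zs ys xs
    using that
  proof (induct arbitrary: zs rule: list_emb.induct)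
    case (list_emb_Nil ys)
    then show ?case
    proof (induct ys)
      case (Cons y ys)
      then show ?case
        using reduced_below_drop[of c zs y ys] \<open>c \<in> carrier G\<close> by simp
    qed simp
  next
    case (list_emb_Cons ys xs x)
    then show ?case
      using reduced_below_drop[of c zs x xs] \<open>c \<in> carrier G\<close> by simp
  next
    case (list_emb_Cons2 y x ys xs)
    then show ?case
      using list_emb_Cons2(3)[of "zs @ [y]"] by simp
  qed
  from this[of ys xs "[]"] show ?thesis
    using assms by simp
qed


section \<open>Multichains and their difference tuples\<close>

definition factor_tuples :: "'a \<Rightarrow> nat \<Rightarrow> (nat \<Rightarrow> 'a) set" where
  "factor_tuples c n =
     {d \<in> {1..n} \<rightarrow>\<^sub>E carrier G. reduced_below c (map d [1..<Suc n])}"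

text \<open>
  The chain condition is local, but by telescoping it is the statement that \<open>P a\<close> followed by
  the successive differences is a reduced factorization of the last element.
\<close>

lemma reduced_differences:
  assumes P: "\<And>i. a \<le> i \<Longrightarrow> i \<le> b \<Longrightarrow> P i \<in> carrier G" and "a \<le> b"
  defines "d \<equiv> \<lambda>i. inv (P i) \<otimes> P (Suc i)"
  shows "P a \<otimes> word_val G (map d [a..<b]) = P b"
    and "reduced (P a # map d [a..<b]) \<longleftrightarrow> (\<forall>i\<in>{a..<b}. P i \<preceq> P (Suc i))"
proof -
  have "P a \<otimes> word_val G (map d [a..<b]) = P b \<and>
      (reduced (P a # map d [a..<b]) \<longleftrightarrow> (\<forall>i\<in>{a..<b}. P i \<preceq> P (Suc i)))"
    using \<open>a \<le> b\<close> P
  proof (induct b rule: dec_induct)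
    case (step b)
    have [simp]: "P i \<in> carrier G" if "a \<le> i" "i \<le> Suc b" for i
      using that step.prems by blast
    have sets [simp]: "set (map d [a..<b]) \<subseteq> carrier G" "P a \<in> carrier G" "P b \<in> carrier G"
      "P (Suc b) \<in> carrier G" "d b \<in> carrier G"
      using \<open>a \<le> b\<close> by (auto simp: d_def image_subset_iff)
    have IH: "P a \<otimes> word_val G (map d [a..<b]) = P b"
      "reduced (P a # map d [a..<b]) \<longleftrightarrow> (\<forall>i\<in>{a..<b}. P i \<preceq> P (Suc i))"
      using step by auto
    have upt: "[a..<Suc b] = [a..<b] @ [b]" using \<open>a \<le> b\<close> by (rule upt_Suc_append)
    have bd: "P b \<otimes> d b = P (Suc b)" by (simp add: d_def)
    have 1: "P a \<otimes> word_val G (map d [a..<Suc b]) = P (Suc b)"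
      unfolding upt map_append
      using sets by (subst word_val_append) (simp_all add: IH(1) bd del: set_map flip: m_assoc)
    have "reduced (P a # map d [a..<Suc b]) \<longleftrightarrow> reduced ((P a # map d [a..<b]) @ [d b])"
      by (simp add: upt)
    also have "\<dots> \<longleftrightarrow> reduced (P a # map d [a..<b]) \<and>
        len (P (Suc b)) = len (P b) + len (d b)"
      using sets by (subst reduced_append_iff) (simp_all add: IH(1) bd del: set_map)
    also have "\<dots> \<longleftrightarrow> reduced (P a # map d [a..<b]) \<and> P b \<preceq> P (Suc b)"
      by (simp add: abs_le_def d_def)
    finally show ?case
      using 1 IH(2) \<open>a \<le> b\<close> by (auto simp: less_Suc_eq)
  qed simp
  then show "P a \<otimes> word_val G (map d [a..<b]) = P b"
    and "reduced (P a # map d [a..<b]) \<longleftrightarrow> (\<forall>i\<in>{a..<b}. P i \<preceq> P (Suc i))"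
    by auto
qed

text \<open>The inverse of \<^const>\<open>delta\<close>: the multichain with given differences, recovered from its end \<open>c\<close>.\<close>

definition partial_quotients :: "'a \<Rightarrow> nat \<Rightarrow> (nat \<Rightarrow> 'a) \<Rightarrow> (nat \<Rightarrow> 'a)" where
  "partial_quotients c n d = (\<lambda>i\<in>{1..n}. c \<otimes> inv (word_val G (map d [i..<Suc n])))"

text \<open>With \<open>c\<close> as the last link, membership of all entries in \<^const>\<open>NC\<close> follows by transitivity.\<close>

lemma NC_multichains_iff:
  assumes c: "c \<in> carrier G"
  shows "p \<in> NC_multichains G S c n \<longleftrightarrow> 
    p \<in> {1..n} \<rightarrow>\<^sub>E carrier G \<and> (\<forall>i\<in>{1..n}. p i \<preceq> (p(Suc n := c)) (Suc i))" (is "?L \<longleftrightarrow> ?R")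
proof
  assume ?L
  then show ?R
    by (auto simp: NC_multichains_def NC_iff PiE_iff less_Suc_eq_le)
next
  assume R: ?R
  have below: "p i \<preceq> c" if "i \<in> {1..n}" for i
  proof -
    from that have "i \<le> n" and "1 \<le> i" by auto
    then show ?thesis
    proof (induct i rule: inc_induct)
      case base
      then show ?case using R by (auto dest!: bspec[of _ _ n])
    next
      case (step m)
      have "p m \<preceq> p (Suc m)"
        using R step.hyps step.prems by (auto dest!: bspec[of _ _ m])
      moreover have "p m \<in> carrier G" "p (Suc m) \<in> carrier G"
        using R step.hyps step.prems by (auto simp: PiE_iff)
      ultimately show ?case
        using step c le_trans[of "p m" "p (Suc m)" c] by simp
    qed
  qed
  have "p i \<preceq> p (Suc i)" if "1 \<le> i" "i < n" for i
    using R that by (auto dest!: bspec[of _ _ i])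
  then show ?L
    using R below by (auto simp: NC_multichains_def NC_iff PiE_iff)
qed

lemma delta_closed:
  assumes "c \<in> carrier G" and "p \<in> {1..n} \<rightarrow>\<^sub>E carrier G"
  shows "delta G c n p \<in> {1..n} \<rightarrow>\<^sub>E carrier G"
  using assms by (auto simp: delta_def PiE_iff)

lemma partial_quotients_closed:
  assumes "c \<in> carrier G" and "d \<in> {1..n} \<rightarrow>\<^sub>E carrier G"
  shows "partial_quotients c n d \<in> {1..n} \<rightarrow>\<^sub>E carrier G"
  using assms by (auto simp: partial_quotients_def PiE_iff image_subset_iff)

lemma partial_quotients_delta:
  assumes c: "c \<in> carrier G" and p: "p \<in> {1..n} \<rightarrow>\<^sub>E carrier G"
  shows "partial_quotients c n (delta G c n p) = p"
proof
  fix i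
  show "partial_quotients c n (delta G c n p) i = p i"
  proof (cases "i \<in> {1..n}")
    case True
    define P where "P = p(Suc n := c)"
    have P: "P j \<in> carrier G" if "i \<le> j" "j \<le> Suc n" for j
      using that True p c by (auto simp: P_def PiE_iff)
    have "map (delta G c n p) [i..<Suc n] = map (\<lambda>i. inv (P i) \<otimes> P (Suc i)) [i..<Suc n]"
      using True by (intro map_cong) (auto simp: delta_def P_def)
    moreover
    have "P i \<otimes> word_val G (map (\<lambda>i. inv (P i) \<otimes> P (Suc i)) [i..<Suc n]) = P (Suc n)"
      using True P by (intro reduced_differences) auto
    ultimately have *: "P i \<otimes> word_val G (map (delta G c n p) [i..<Suc n]) = c"
      by (metis P_def fun_upd_same)
    have "set (map (delta G c n p) [i..<Suc n]) \<subseteq> carrier G"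
      using delta_closed[OF c p] True by (auto simp: PiE_iff)
    then have v: "word_val G (map (delta G c n p) [i..<Suc n]) \<in> carrier G"
      by (rule word_val_closed)
    have "P i \<in> carrier G" using P True by simp
    then have "c \<otimes> inv (word_val G (map (delta G c n p) [i..<Suc n])) = P i"
      using * v c by (metis inv_solve_right)
    then show ?thesis using True by (simp add: partial_quotients_def P_def)
  qed (use p in \<open>auto simp: partial_quotients_def PiE_iff extensional_def\<close>)
qed

lemma delta_partial_quotients:
  assumes c: "c \<in> carrier G" and d: "d \<in> {1..n} \<rightarrow>\<^sub>E carrier G"
  shows "delta G c n (partial_quotients c n d) = d"
proof
  fix i
  show "delta G c n (partial_quotients c n d) i = d i"
  proof (cases "i \<in> {1..n}")
    case True
    have "set (map d [j..<Suc n]) \<subseteq> carrier G" if "1 \<le> j" for j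
      using d that by (auto simp: PiE_iff)
    then have val: "word_val G (map d [j..<Suc n]) \<in> carrier G" if "1 \<le> j" for j
      using that by (intro word_val_closed)
    have nxt: "((partial_quotients c n d)(Suc n := c)) (Suc i) =
        c \<otimes> inv (word_val G (map d [Suc i..<Suc n]))"
      using True c by (cases "i = n") (auto simp: partial_quotients_def)
    have "[i..<Suc n] = i # [Suc i..<Suc n]"
      using True by (simp add: upt_conv_Cons)
    then have "word_val G (map d [i..<Suc n]) = d i \<otimes> word_val G (map d [Suc i..<Suc n])"
      by simp
    moreover have "d i \<in> carrier G" using d True by (auto simp: PiE_iff)
    moreover have "delta G c n (partial_quotients c n d) i =
        inv (c \<otimes> inv (word_val G (map d [i..<Suc n]))) \<otimes>
        (c \<otimes> inv (word_val G (map d [Suc i..<Suc n])))"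
      using True unfolding delta_def by (simp only: restrict_apply' nxt) (simp add: partial_quotients_def)
    ultimately show ?thesis
      using c val[of "Suc i"] by (simp add: inv_mult_group m_assoc)
  qed (use d in \<open>auto simp: delta_def PiE_iff extensional_def\<close>)
qed

text \<open>
  If \<open>v\<close> is the product of the differences, then \<open>c = p\<^sub>1 v\<close>. Being a multichain means that
  the word \<open>p\<^sub>1, d\<^sub>1, \<dots>, d\<^sub>n\<close> is reduced, whereas \<open>v \<le> c\<close> speaks of \<open>v\<^sup>-\<^sup>1 c\<close>. The latter is a conjugate of \<open>p\<^sub>1\<close>,
  so both conditions compare the same lengths.
\<close>

lemma delta_in_factor_tuples_iff:
  assumes c: "c \<in> carrier G" and p: "p \<in> {1..n} \<rightarrow>\<^sub>E carrier G"
  shows "delta G c n p \<in> factor_tuples c n \<longleftrightarrow> p \<in> NC_multichains G S c n"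
proof -
  define P where "P = p(Suc n := c)"
  define d where "d = delta G c n p"
  define v where "v = word_val G (map d [1..<Suc n])"
  have P: "P j \<in> carrier G" if "1 \<le> j" "j \<le> Suc n" for j
    using that p c by (auto simp: P_def PiE_iff)
  have d_closed: "d \<in> {1..n} \<rightarrow>\<^sub>E carrier G"
    unfolding d_def by (rule delta_closed[OF c p])
  then have set_d: "set (map d [1..<Suc n]) \<subseteq> carrier G"
    by (auto simp: PiE_iff)
  then have v: "v \<in> carrier G" unfolding v_def by (rule word_val_closed)
  have d: "map d [1..<Suc n] = map (\<lambda>i. inv (P i) \<otimes> P (Suc i)) [1..<Suc n]"
    by (intro map_cong) (auto simp: delta_def P_def d_def)
  have Pv: "P 1 \<otimes> v = c"
    unfolding v_def d using reduced_differences(1)[of 1 "Suc n" P] P by (simp add: P_def)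
  have "reduced (P 1 # map d [1..<Suc n]) \<longleftrightarrow> (\<forall>i\<in>{1..<Suc n}. P i \<preceq> P (Suc i))"
    unfolding d by (rule reduced_differences) (use P in auto)
  also have "\<dots> \<longleftrightarrow> p \<in> NC_multichains G S c n"
    using p by (auto simp: NC_multichains_iff[OF c] P_def)
  finally have "p \<in> NC_multichains G S c n \<longleftrightarrow> reduced ([P 1] @ map d [1..<Suc n])"
    by simp
  also have "\<dots> \<longleftrightarrow> reduced (map d [1..<Suc n]) \<and> len c = len (P 1) + len v"
    using P[of 1] set_d Pv
    by (subst reduced_append_iff) (auto simp: v_def)
  also have "len (P 1) = len (inv v \<otimes> c)"
  proof -
    have "inv v \<otimes> c = inv v \<otimes> P 1 \<otimes> inv (inv v)"
      using Pv v P[of 1] by (simp add: m_assoc)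
    then show ?thesis using len_conj[of "P 1" "inv v"] v P[of 1] by simp
  qed
  finally show ?thesis
    using d_closed by (auto simp: factor_tuples_def reduced_below_def abs_le_def v_def d_def)
qed

lemma bij_betw_delta:
  assumes c: "c \<in> carrier G"
  shows "bij_betw (delta G c n) (NC_multichains G S c n) (factor_tuples c n)"
proof (rule bij_betw_byWitness[where f' = "partial_quotients c n"])
  have sub: "NC_multichains G S c n \<subseteq> {1..n} \<rightarrow>\<^sub>E carrier G"
    using NC_multichains_iff[OF c] by blast
  have sub': "factor_tuples c n \<subseteq> {1..n} \<rightarrow>\<^sub>E carrier G"
    by (auto simp: factor_tuples_def)
  show "\<forall>p\<in>NC_multichains G S c n. partial_quotients c n (delta G c n p) = p"
    using partial_quotients_delta[OF c] sub by blast
  show right: "\<forall>d\<in>factor_tuples c n. delta G c n (partial_quotients c n d) = d"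
    using delta_partial_quotients[OF c] sub' by blast
  show "delta G c n ` NC_multichains G S c n \<subseteq> factor_tuples c n"
    using delta_in_factor_tuples_iff[OF c] sub by blast
  show "partial_quotients c n ` factor_tuples c n \<subseteq> NC_multichains G S c n"
  proof
    fix p assume "p \<in> partial_quotients c n ` factor_tuples c n"
    then obtain d where d: "d \<in> factor_tuples c n" "p = partial_quotients c n d" by auto
    then have "p \<in> {1..n} \<rightarrow>\<^sub>E carrier G" "delta G c n p \<in> factor_tuples c n"
      using right sub' partial_quotients_closed[OF c, of d n] by auto
    then show "p \<in> NC_multichains G S c n"
      using delta_in_factor_tuples_iff[OF c] by blast
  qed
qed


section \<open>Kreweras-type anti-automorphisms\<close>

text \<open>
  Both \<open>K w = w\<^sup>-\<^sup>1 c\<close> and its inverse \<open>w \<mapsto> c w\<^sup>-\<^sup>1 = c w\<^sup>-\<^sup>1 c\<^sup>-\<^sup>1 c\<close> are of the form \<open>a w\<^sup>-\<^sup>1 a\<^sup>-\<^sup>1 c\<close> with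
  \<open>a\<close> commuting with \<open>c\<close>, for \<open>a = 1\<close> and \<open>a = c\<close>. Two applications of such a map amount to a conjugation by
  an element commuting with \<open>c\<close>, so the form survives for every odd power.
\<close>

lemma kreweras_type_conjugation:
  assumes c: "c \<in> carrier G" and "kreweras_type G S c \<Psi>"
  obtains g where "g \<in> carrier G" "g \<otimes> c = c \<otimes> g"
    "\<And>w. w \<in> NC G S c \<Longrightarrow> \<Psi> w = g \<otimes> inv w \<otimes> inv g \<otimes> c"
proof -
  let ?N = "NC G S c"
  have N [simp]: "w \<in> carrier G" if "w \<in> ?N" for w
    using that by (simp add: NC_iff)
  have power_form: "\<exists>g\<in>carrier G. g \<otimes> c = c \<otimes> g \<and> (\<forall>w\<in>?N. (f ^^ n) w = g \<otimes> inv w \<otimes> inv g \<otimes> c)"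
    if f: "\<And>w. w \<in> ?N \<Longrightarrow> f w = a \<otimes> inv w \<otimes> inv a \<otimes> c" "\<And>w. w \<in> ?N \<Longrightarrow> f w \<in> ?N"
      and a [simp]: "a \<in> carrier G" and ac: "a \<otimes> c = c \<otimes> a" and "odd n" for f a n
  proof -
    have closed: "(f ^^ n) w \<in> ?N" if "w \<in> ?N" for n w
      using that f(2) by (induct n) auto
    have ac': "c \<otimes> inv a = inv a \<otimes> c"
      using ac c by (metis a inv_closed inv_cancel_left(2) inv_solve_right m_assoc m_closed)
    obtain m where n: "n = Suc (2 * m)"
      using \<open>odd n\<close> by (auto elim: oddE)
    have "\<exists>g\<in>carrier G. g \<otimes> c = c \<otimes> g \<and>
        (\<forall>w\<in>?N. (f ^^ Suc (2 * m)) w = g \<otimes> inv w \<otimes> inv g \<otimes> c)"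
    proof (induct m)
      case 0
      then show ?case using f ac by auto
    next
      case (Suc m)
      then obtain g where g [simp]: "g \<in> carrier G" and gc: "g \<otimes> c = c \<otimes> g"
        and fg: "\<And>w. w \<in> ?N \<Longrightarrow> (f ^^ Suc (2 * m)) w = g \<otimes> inv w \<otimes> inv g \<otimes> c"
        by blast
      \<comment> \<open>Read off from \<open>f (f x) = a c\<^sup>-\<^sup>1 a x a\<^sup>-\<^sup>1 a\<^sup>-\<^sup>1 c\<close> with \<open>x = g w\<^sup>-\<^sup>1 g\<^sup>-\<^sup>1 c\<close>.\<close>
      define g' where "g' = a \<otimes> inv c \<otimes> a \<otimes> g"
      have "g' \<in> carrier G" using c by (simp add: g'_def)
      moreover have "g' \<otimes> c = c \<otimes> g'"
      proof -
        have "g' \<otimes> c = a \<otimes> (inv c \<otimes> (a \<otimes> c)) \<otimes> g"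
          using c gc by (simp add: g'_def m_assoc)
        also have "\<dots> = a \<otimes> a \<otimes> g"
          using c by (simp add: ac)
        also have "\<dots> = (c \<otimes> a) \<otimes> (inv c \<otimes> (a \<otimes> g))"
          using c by (simp add: m_assoc flip: ac)
        finally show ?thesis
          using c by (simp add: g'_def m_assoc)
      qed
      moreover have "(f ^^ Suc (2 * Suc m)) w = g' \<otimes> inv w \<otimes> inv g' \<otimes> c" if w: "w \<in> ?N" for w
      proof -
        define x where "x = (f ^^ Suc (2 * m)) w"
        have x: "x \<in> ?N" unfolding x_def by (rule closed[OF w])
        have "(f ^^ Suc (2 * Suc m)) w = f (f x)"
          by (simp add: x_def)
        also have "\<dots> = a \<otimes> inv (a \<otimes> inv x \<otimes> inv a \<otimes> c) \<otimes> inv a \<otimes> c"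
          using f x by metis
        also have "\<dots> = a \<otimes> inv c \<otimes> a \<otimes> x \<otimes> inv a \<otimes> inv a \<otimes> c"
          using c x by (simp add: inv_mult_group m_assoc)
        also have "\<dots> = a \<otimes> inv c \<otimes> a \<otimes> g \<otimes> inv w \<otimes> inv g \<otimes> (c \<otimes> inv a) \<otimes> inv a \<otimes> c"
          using c w fg[OF w] by (simp add: x_def m_assoc)
        also have "\<dots> = g' \<otimes> inv w \<otimes> inv g' \<otimes> c"
          using c w by (simp add: g'_def inv_mult_group m_assoc ac')
        finally show ?thesis .
      qed
      ultimately show ?case by blast
    qed
    then show ?thesis by (simp add: n)
  qed
  have K_NC: "kreweras G c w \<in> ?N" if "w \<in> ?N" for w
  proof -
    have "inv (inv w \<otimes> c) \<otimes> c = inv c \<otimes> w \<otimes> inv (inv c)"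
      using that c by (simp add: inv_mult_group)
    then have "len (inv (inv w \<otimes> c) \<otimes> c) = len w"
      using len_conj[of w "inv c"] that c by simp
    moreover have "len c = len w + len (inv w \<otimes> c)"
      using that by (simp add: NC_iff abs_le_def)
    ultimately have "inv w \<otimes> c \<preceq> c"
      unfolding abs_le_def by linarith
    then show ?thesis
      using that c by (simp add: NC_iff kreweras_def)
  qed
  have J_NC: "c \<otimes> inv w \<in> ?N" if "w \<in> ?N" for w
  proof -
    have "inv (c \<otimes> inv w) \<otimes> c = w"
      using that c by (simp add: inv_mult_group m_assoc)
    moreover have "len c = len w + len (inv w \<otimes> c)"
      using that by (simp add: NC_iff abs_le_def)
    moreover have "len (inv w \<otimes> c) = len (c \<otimes> inv w)"
      using that c by (intro len_mult_swap) auto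
    ultimately have "c \<otimes> inv w \<preceq> c"
      unfolding abs_le_def by simp
    then show ?thesis
      using that c by (simp add: NC_iff)
  qed
  have inj: "inj_on (kreweras G c) ?N"
    using c by (intro inj_onI) (simp add: kreweras_def, metis N inv_inv)
  have J: "inv_into ?N (kreweras G c) w = c \<otimes> inv w" if "w \<in> ?N" for w
    using that c by (intro inv_into_f_eq[OF inj J_NC])
      (simp_all add: kreweras_def inv_mult_group m_assoc)
  obtain n where "odd n"
    and "\<Psi> = kreweras G c ^^ n \<or> \<Psi> = inv_into ?N (kreweras G c) ^^ n"
    using assms(2) by (auto simp: kreweras_type_def)
  then show ?thesis
    using that power_form[of "kreweras G c" \<one> n] power_form[of "inv_into ?N (kreweras G c)" c n]
      K_NC J_NC J c
    by (auto simp: kreweras_def m_assoc)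
qed


section \<open>Matrices of factors\<close>

lemma factor_tuple_NC:
  assumes c: "c \<in> carrier G" and d: "d \<in> factor_tuples c n" and j: "j \<in> {1..n}"
  shows "d j \<in> NC G S c"
proof -
  have d': "d \<in> {1..n} \<rightarrow>\<^sub>E carrier G" "reduced_below c (map d [1..<Suc n])"
    using d by (auto simp: factor_tuples_def)
  have "subseq [d j] (map d [1..<Suc n])"
    using j by (subst subseq_singleton_left) auto
  then have "reduced_below c [d j]"
    using d' c by (rule_tac reduced_below_subseq) (auto simp: PiE_iff)
  then show ?thesis
    using d' j by (auto simp: NC_iff reduced_below_def PiE_iff)
qed

text \<open>
  Forwards, every column and every concatenation of column tails is a subword of the whole
  word, and a tail tuple lists the block products of such a concatenation. Backwards, the columns
  are the blocks of the whole word and the tail tuple for row \<open>1\<close> lists their products.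
\<close>

lemma reduced_below_matrix_iff:
  assumes c: "c \<in> carrier G" and "1 \<le> l"
    and x: "\<And>i j. i \<in> {1..l} \<Longrightarrow> j \<in> {1..k} \<Longrightarrow> x i j \<in> carrier G"
  shows "reduced_below c (concat (map (\<lambda>j. map (\<lambda>i. x i j) [1..<Suc l]) [1..<Suc k])) \<longleftrightarrow>
    (\<forall>j\<in>{1..k}. reduced_below c (map (\<lambda>i. x i j) [1..<Suc l])) \<and>
    (\<forall>i\<in>{1..l}. (\<lambda>j\<in>{1..k}. word_val G (map (\<lambda>i. x i j) [i..<Suc l])) \<in> factor_tuples c k)"
    (is "?L \<longleftrightarrow> ?cols \<and> ?tails")
proof -
  define block where "block i j = map (\<lambda>i. x i j) [i..<Suc l]" for i j
  define blocks where "blocks i = map (block i) [1..<Suc k]" for i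
  have block: "set (block i j) \<subseteq> carrier G" if "1 \<le> i" "j \<in> {1..k}" for i j
    using that x by (auto simp: block_def)
  then have blocks: "set xs \<subseteq> carrier G" if "1 \<le> i" "xs \<in> set (blocks i)" for i xs
    using that by (fastforce simp: blocks_def)
  have concat_closed: "set (concat (blocks i)) \<subseteq> carrier G" if "1 \<le> i" for i
    using blocks[OF that] by auto
  have tail_iff: "(\<lambda>j\<in>{1..k}. word_val G (block i j)) \<in> factor_tuples c k \<longleftrightarrow>
      reduced_below c (map (word_val G) (blocks i))" if i: "1 \<le> i" for i
  proof -
    have "map (\<lambda>j\<in>{1..k}. word_val G (block i j)) [1..<Suc k] = map (word_val G) (blocks i)"
      by (simp add: blocks_def)
    then show ?thesis
      using block[OF i] by (auto simp: factor_tuples_def)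
  qed
  have concat_iff: "reduced_below c (concat (blocks i)) \<longleftrightarrow>
      (\<forall>xs\<in>set (blocks i). reduced xs) \<and> reduced_below c (map (word_val G) (blocks i))"
    if i: "1 \<le> i" for i
    using blocks[OF i] by (auto simp: reduced_below_def reduced_concat_iff word_val_concat)
  have "?cols \<and> ?tails" if L: "reduced_below c (concat (blocks 1))"
  proof
    show ?cols
    proof
      fix j assume "j \<in> {1..k}"
      then have "block 1 j \<in> set (blocks 1)" by (auto simp: blocks_def)
      then have "reduced_below c (block 1 j)"
        using reduced_below_subseq[OF subseq_concat L c concat_closed] by simp
      then show "reduced_below c (map (\<lambda>i. x i j) [1..<Suc l])"
        by (simp add: block_def)
    qed
    show ?tails
    proof
      fix i assume i: "i \<in> {1..l}"
      have "[1..<Suc l] = [1..<i] @ [i..<Suc l]"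
        using i by (metis atLeastAtMost_iff le_SucI le_add_diff_inverse upt_add_eq_append)
      then have "subseq (block i j) (block 1 j)" for j
        unfolding block_def by (simp add: subseq_drop_many)
      then have "subseq (concat (blocks i)) (concat (blocks 1))"
        unfolding blocks_def by (rule subseq_concat_map)
      then have "reduced_below c (concat (blocks i))"
        using reduced_below_subseq[OF _ L c concat_closed] by simp
      then have "(\<lambda>j\<in>{1..k}. word_val G (block i j)) \<in> factor_tuples c k"
        using i concat_iff tail_iff by simp
      then show "(\<lambda>j\<in>{1..k}. word_val G (map (\<lambda>i. x i j) [i..<Suc l])) \<in> factor_tuples c k"
        by (simp add: block_def)
    qed
  qed
  moreover have "reduced_below c (concat (blocks 1))" if ?cols ?tails
  proof -
    have "(\<lambda>j\<in>{1..k}. word_val G (block 1 j)) \<in> factor_tuples c k"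
      using \<open>?tails\<close> \<open>1 \<le> l\<close> by (simp add: block_def)
    moreover have "\<forall>xs\<in>set (blocks 1). reduced xs"
      using \<open>?cols\<close> by (auto simp: blocks_def block_def reduced_below_def)
    ultimately show ?thesis
      using concat_iff[of 1] tail_iff[of 1] by simp
  qed
  moreover have "concat (map (\<lambda>j. map (\<lambda>i. x i j) [1..<Suc l]) [1..<Suc k]) = concat (blocks 1)"
    by (simp add: blocks_def block_def[abs_def])
  ultimately show ?thesis by auto
qed


section \<open>Powers of the group\<close>

lemma word_val_power:
  assumes "j \<in> {1..k}"
  shows "set fs \<subseteq> carrier (power_group G k) \<Longrightarrow>
    word_val (power_group G k) fs j = word_val G (map (\<lambda>f. f j) fs)"
  using assms by (induct fs) auto

lemma reflections_power:
  "reflections (power_group G k) (power_gens G S k) =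
     {f \<in> carrier (power_group G k). \<exists>i\<in>{1..k}. f i \<in> reflections G S \<and> (\<forall>j\<in>{1..k} - {i}. f j = \<one>)}"
    (is "?L = ?R")
proof
  show "?L \<subseteq> ?R"
  proof
    fix f assume "f \<in> ?L"
    then obtain w s i where w: "w \<in> {1..k} \<rightarrow>\<^sub>E carrier G" and s: "s \<in> {1..k} \<rightarrow>\<^sub>E carrier G"
      and i: "i \<in> {1..k}" "s i \<in> S" "\<forall>j\<in>{1..k} - {i}. s j = \<one>"
      and f: "f = w \<otimes>\<^bsub>power_group G k\<^esub> s \<otimes>\<^bsub>power_group G k\<^esub> inv\<^bsub>power_group G k\<^esub> w"
      unfolding reflections_def power_gens_def by auto
    have f': "f = (\<lambda>j\<in>{1..k}. w j \<otimes> s j \<otimes> inv (w j))"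
      using w by (auto simp: f)
    have "f i = w i \<otimes> s i \<otimes> inv (w i)" "w i \<in> carrier G"
      using i w by (auto simp: f' PiE_iff)
    then have "f i \<in> reflections G S"
      using i unfolding reflections_def by blast
    moreover have "\<forall>j\<in>{1..k} - {i}. f j = \<one>"
      using i w by (auto simp: f' PiE_iff)
    moreover have "f \<in> carrier (power_group G k)"
      using w s by (auto simp: f' PiE_iff)
    ultimately show "f \<in> ?R" using i by blast
  qed
  show "?R \<subseteq> ?L"
  proof
    fix f assume "f \<in> ?R"
    then obtain i s w where f: "f \<in> {1..k} \<rightarrow>\<^sub>E carrier G" and i: "i \<in> {1..k}"
      and sw: "s \<in> S" "w \<in> carrier G" "f i = w \<otimes> s \<otimes> inv w"
      and triv: "\<And>j. j \<in> {1..k} - {i} \<Longrightarrow> f j = \<one>"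
      by (auto simp: reflections_def)
    define s' where "s' = (\<lambda>j\<in>{1..k}. if j = i then s else \<one>)"
    define w' where "w' = (\<lambda>j\<in>{1..k}. if j = i then w else \<one>)"
    have "s \<in> carrier G" using sw gens_closed by auto
    then have "s' \<in> power_gens G S k"
      using i sw by (auto simp: power_gens_def s'_def)
    moreover have w': "w' \<in> carrier (power_group G k)"
      using sw by (auto simp: w'_def)
    moreover have "f = w' \<otimes>\<^bsub>power_group G k\<^esub> s' \<otimes>\<^bsub>power_group G k\<^esub> inv\<^bsub>power_group G k\<^esub> w'"
    proof
      fix j
      show "f j = (w' \<otimes>\<^bsub>power_group G k\<^esub> s' \<otimes>\<^bsub>power_group G k\<^esub> inv\<^bsub>power_group G k\<^esub> w') j"
        using f i sw triv w' by (auto simp: w'_def s'_def PiE_iff extensional_def)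
    qed
    ultimately show "f \<in> ?L"
      unfolding reflections_def by blast
  qed
qed

text \<open>
  A reflection of the power group moves one coordinate only, and by a reflection of \<open>G\<close>. Hence a
  word of reflections pays separately for every coordinate.
\<close>

lemma power_word_lower:
  "fs \<in> lists (reflections (power_group G k) (power_gens G S k)) \<Longrightarrow>
     (\<Sum>j\<in>{1..k}. len (word_val (power_group G k) fs j)) \<le> length fs"
proof (induct fs)
  case Nil
  then show ?case by simp
next
  case (Cons f fs)
  interpret P: group "power_group G k" by simp
  define g where "g = word_val (power_group G k) fs"
  have "set fs \<subseteq> carrier (power_group G k)"
    using Cons.prems by (auto simp: reflections_power simp del: carrier_product_group)
  then have g: "g \<in> {1..k} \<rightarrow>\<^sub>E carrier G"
    using P.word_val_closed unfolding g_def by auto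
  obtain i where f: "f \<in> {1..k} \<rightarrow>\<^sub>E carrier G" and i: "i \<in> {1..k}" "f i \<in> reflections G S"
    and triv: "\<And>j. j \<in> {1..k} - {i} \<Longrightarrow> f j = \<one>"
    using Cons.prems by (auto simp: reflections_power)
  have "len (f i) \<le> 1"
    using len_le[of "[f i]"] i f by (auto simp: PiE_iff)
  then have "len (f j \<otimes> g j) \<le> (if j = i then 1 else 0) + len (g j)" if "j \<in> {1..k}" for j
    using len_mult[of "f j" "g j"] f g that triv[of j] by (auto simp: PiE_iff)
  then have "(\<Sum>j\<in>{1..k}. len (f j \<otimes> g j)) \<le> (\<Sum>j\<in>{1..k}. (if j = i then 1 else 0) + len (g j))"
    by (rule sum_mono)
  also have "\<dots> = 1 + (\<Sum>j\<in>{1..k}. len (g j))"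
    using i by (simp add: sum.distrib)
  finally show ?case
    using Cons by (simp add: g_def)
qed

text \<open>
  Peeling off the first reflection of a shortest word for some nontrivial coordinate lowers the sum
  of the lengths by one.
\<close>

lemma power_word_exists:
  assumes "f \<in> carrier (power_group G k)"
  shows "\<exists>fs\<in>lists (reflections (power_group G k) (power_gens G S k)).
    length fs = (\<Sum>j\<in>{1..k}. len (f j)) \<and> word_val (power_group G k) fs = f"
  using assms
proof (induct "\<Sum>j\<in>{1..k}. len (f j)" arbitrary: f)
  case 0
  then have "f = (\<lambda>j\<in>{1..k}. \<one>)"
    by (auto simp: fun_eq_iff PiE_iff extensional_def)
  then show ?case using 0 by (intro bexI[of _ "[]"]) auto
next
  case (Suc n)
  interpret P: group "power_group G k" by simp
  have f: "f \<in> {1..k} \<rightarrow>\<^sub>E carrier G" using Suc.prems by simp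
  have "\<exists>i\<in>{1..k}. len (f i) \<noteq> 0"
  proof (rule ccontr)
    assume "\<not> ?thesis"
    then have "(\<Sum>j\<in>{1..k}. len (f j)) = 0" by (intro sum.neutral) blast
    then show False using Suc.hyps(2) by linarith
  qed
  then obtain i where i: "i \<in> {1..k}" "len (f i) \<noteq> 0"
    by blast
  have fi: "f i \<in> carrier G" using f i by (auto simp: PiE_iff)
  obtain ts where ts: "ts \<in> lists (reflections G S)" "length ts = len (f i)" "word_val G ts = f i"
    using len_word[OF fi] .
  then obtain t us where tus: "ts = t # us" using i by (cases ts) auto
  have t: "t \<in> reflections G S" "t \<in> carrier G" and us: "set us \<subseteq> carrier G" "us \<in> lists (reflections G S)"
    using ts(1) tus reflections_closed by auto
  define u where "u = word_val G us"
  have u: "u \<in> carrier G" using us by (simp add: u_def)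
  have tu: "f i = t \<otimes> u" using ts tus by (simp add: u_def)
  have "len (f i) \<le> len t + len u" using tu t u len_mult by simp
  moreover have "len t \<le> 1" using len_le[of "[t]"] t by simp
  moreover have "len u \<le> length us" using len_le us u_def by simp
  ultimately have lenu: "len (f i) = Suc (len u)" using ts(2) tus by simp
  define g where "g = f(i := u)"
  define r where "r = (\<lambda>j\<in>{1..k}. if j = i then t else \<one>)"
  have g: "g \<in> carrier (power_group G k)"
    using f u i by (auto simp: g_def PiE_iff extensional_def)
  have "(\<Sum>j\<in>{1..k}. len (f j)) = Suc (\<Sum>j\<in>{1..k}. len (g j))"
    using i lenu by (simp add: sum.remove[of _ i] g_def)
  then have "n = (\<Sum>j\<in>{1..k}. len (g j))"
    using Suc.hyps(2) by simp
  then obtain fs where fs: "fs \<in> lists (reflections (power_group G k) (power_gens G S k))"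
      "length fs = n" "word_val (power_group G k) fs = g"
    using Suc.hyps(1)[OF _ g] by auto
  have "r \<in> reflections (power_group G k) (power_gens G S k)"
    using t i by (auto simp: reflections_power r_def)
  moreover have "word_val (power_group G k) (r # fs) = f"
  proof
    fix j
    show "word_val (power_group G k) (r # fs) j = f j"
      using fs f i tu by (auto simp: r_def g_def PiE_iff extensional_def)
  qed
  ultimately show ?case
    using fs Suc.hyps(2) by (intro bexI[of _ "r # fs"]) auto
qed

lemma power_reflection_generated:
  "reflection_generated (power_group G k) (power_gens G S k)"
proof (intro reflection_generated.intro reflection_generated_axioms.intro)
  show "power_gens G S k \<subseteq> carrier (power_group G k)"
    by (auto simp: power_gens_def)
qed (use power_word_exists in \<open>auto simp del: carrier_product_group\<close>)

lemma len_power: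
  assumes f: "f \<in> carrier (power_group G k)"
  shows "abs_length (power_group G k) (power_gens G S k) f = (\<Sum>j\<in>{1..k}. len (f j))"
proof (rule antisym)
  interpret P: reflection_generated "power_group G k" "power_gens G S k"
    by (rule power_reflection_generated)
  show "abs_length (power_group G k) (power_gens G S k) f \<le> (\<Sum>j\<in>{1..k}. len (f j))"
    using power_word_exists[OF f] P.len_le by metis
  show "(\<Sum>j\<in>{1..k}. len (f j)) \<le> abs_length (power_group G k) (power_gens G S k) f"
    using P.len_word[OF f] power_word_lower by metis
qed

text \<open>
  Length is a sum over coordinates and subadditive in each of them, so additivity of the sum
  forces additivity in every coordinate.
\<close>

lemma power_le_iff:
  assumes f: "f \<in> carrier (power_group G k)" and g: "g \<in> carrier (power_group G k)"
  shows "abs_le (power_group G k) (power_gens G S k) f g \<longleftrightarrow> (\<forall>j\<in>{1..k}. f j \<preceq> g j)"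
proof -
  have fg: "f \<in> {1..k} \<rightarrow>\<^sub>E carrier G" "g \<in> {1..k} \<rightarrow>\<^sub>E carrier G"
    using f g by auto
  interpret P: group "power_group G k" by simp
  define q where "q = inv\<^bsub>power_group G k\<^esub> f \<otimes>\<^bsub>power_group G k\<^esub> g"
  have q_closed: "q \<in> carrier (power_group G k)"
    unfolding q_def using f g by blast
  have q: "q j = inv (f j) \<otimes> g j" if "j \<in> {1..k}" for j
    using fg that by (simp add: q_def)
  have le: "len (g j) \<le> len (f j) + len (q j)" if "j \<in> {1..k}" for j
    using len_quotient_le[of "f j" "g j"] fg that by (auto simp: q PiE_iff)
  have "abs_le (power_group G k) (power_gens G S k) f g \<longleftrightarrow>
      (\<Sum>j\<in>{1..k}. len (g j)) = (\<Sum>j\<in>{1..k}. len (f j) + len (q j))"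
    unfolding abs_le_def len_power[OF f] len_power[OF g] q_def[symmetric] len_power[OF q_closed]
    by (simp add: sum.distrib)
  also have "\<dots> \<longleftrightarrow> (\<forall>j\<in>{1..k}. len (g j) = len (f j) + len (q j))"
    using sum_mono_inv[of "\<lambda>j. len (g j)" "{1..k}" "\<lambda>j. len (f j) + len (q j)"] le
    by (auto intro: sum.cong)
  also have "\<dots> \<longleftrightarrow> (\<forall>j\<in>{1..k}. f j \<preceq> g j)"
    by (auto simp: abs_le_def q)
  finally show ?thesis .
qed

lemma power_elt_closed: "c \<in> carrier G \<Longrightarrow> power_elt c k \<in> carrier (power_group G k)"
  by (auto simp: power_elt_def)

lemma power_reduced_below_iff:
  assumes c: "c \<in> carrier G" and fs: "set fs \<subseteq> carrier (power_group G k)"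
  shows "reflection_generated.reduced_below (power_group G k) (power_gens G S k) (power_elt c k) fs \<longleftrightarrow>
    (\<forall>j\<in>{1..k}. reduced_below c (map (\<lambda>f. f j) fs))"
proof -
  interpret P: reflection_generated "power_group G k" "power_gens G S k"
    by (rule power_reflection_generated)
  define v where "v = word_val (power_group G k) fs"
  have v_closed: "v \<in> carrier (power_group G k)"
    unfolding v_def by (rule P.word_val_closed[OF fs])
  have v: "v j = word_val G (map (\<lambda>f. f j) fs)" if "j \<in> {1..k}" for j
    using word_val_power[OF that fs] by (simp add: v_def)
  have closed: "set (map (\<lambda>f. f j) fs) \<subseteq> carrier G" if "j \<in> {1..k}" for j
    using fs that by (auto simp: PiE_iff)
  have total: "sum_list (map P.len fs) = (\<Sum>j\<in>{1..k}. sum_list (map len (map (\<lambda>f. f j) fs)))"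
    using fs by (induct fs) (simp_all add: len_power sum.distrib del: carrier_product_group)
  have "P.reduced fs \<longleftrightarrow>
      (\<Sum>j\<in>{1..k}. len (v j)) = (\<Sum>j\<in>{1..k}. sum_list (map len (map (\<lambda>f. f j) fs)))"
    unfolding P.reduced_def total v_def[symmetric] len_power[OF v_closed] ..
  also have "\<dots> \<longleftrightarrow> (\<forall>j\<in>{1..k}. len (v j) = sum_list (map len (map (\<lambda>f. f j) fs)))"
    using sum_mono_inv[of "\<lambda>j. len (v j)" "{1..k}" "\<lambda>j. sum_list (map len (map (\<lambda>f. f j) fs))"]
      len_word_val[OF closed] v
    by (auto intro: sum.cong)
  finally have "P.reduced fs \<longleftrightarrow> (\<forall>j\<in>{1..k}. reduced (map (\<lambda>f. f j) fs))"
    by (simp add: reduced_def v)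
  moreover have "P.le_T v (power_elt c k) \<longleftrightarrow> (\<forall>j\<in>{1..k}. word_val G (map (\<lambda>f. f j) fs) \<preceq> c)"
    unfolding power_le_iff[OF v_closed power_elt_closed[OF c]] by (simp add: v power_elt_def)
  ultimately show ?thesis
    by (auto simp: P.reduced_below_def reduced_below_def v_def)
qed

lemma power_NC_iff:
  assumes c: "c \<in> carrier G"
  shows "f \<in> NC (power_group G k) (power_gens G S k) (power_elt c k) \<longleftrightarrow> f \<in> {1..k} \<rightarrow>\<^sub>E NC G S c"
proof -
  interpret P: reflection_generated "power_group G k" "power_gens G S k"
    by (rule power_reflection_generated)
  show ?thesis
    unfolding P.NC_iff using power_le_iff[OF _ power_elt_closed[OF c], of f]
    by (auto simp: NC_iff PiE_iff power_elt_def)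
qed


end


section \<open>Flattening a matrix of factors\<close>

text \<open>
  Position \<open>(j - 1) * l + i\<close> of the flattened tuple holds the matrix entry in row \<open>i\<close> and column \<open>j\<close>, all
  counted from \<open>1\<close>: the columns are the consecutive blocks, each of length \<open>l\<close>.
\<close>

lemma block_index:
  assumes "i \<in> {1..l}" "j \<in> {1..k}"
  shows "(j - 1) * l + i \<in> {1..k * l}"
    and "Suc (((j - 1) * l + i - 1) mod l) = i" and "Suc (((j - 1) * l + i - 1) div l) = j"
proof -
  obtain a b where i: "i = Suc a" and j: "j = Suc b" and ab: "a < l" "b < k"
    using assms by (cases i; cases j) auto
  have "Suc b * l \<le> k * l" using ab by (intro mult_le_mono1) simp
  then show "(j - 1) * l + i \<in> {1..k * l}" using ab by (simp add: i j)
  show "Suc (((j - 1) * l + i - 1) mod l) = i" "Suc (((j - 1) * l + i - 1) div l) = j"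
    using ab by (simp_all add: i j)
qed

lemma block_coordinates:
  assumes "n \<in> {1..k * l}"
  shows "Suc ((n - 1) mod l) \<in> {1..l}" "Suc ((n - 1) div l) \<in> {1..k}"
    and "(Suc ((n - 1) div l) - 1) * l + Suc ((n - 1) mod l) = n"
proof -
  have l: "0 < l" using assms by (cases l) auto
  then show "Suc ((n - 1) mod l) \<in> {1..l}" by (simp add: Suc_leI)
  have "n - 1 < k * l" using assms by auto
  then have "(n - 1) div l < k" by (rule less_mult_imp_div_less)
  then show "Suc ((n - 1) div l) \<in> {1..k}" by simp
  show "(Suc ((n - 1) div l) - 1) * l + Suc ((n - 1) mod l) = n"
    using assms by simp
qed

lemma ball_flatten:
  fixes k l :: nat
  shows "(\<forall>n\<in>{1..k * l}. Q n) \<longleftrightarrow> (\<forall>i\<in>{1..l}. \<forall>j\<in>{1..k}. Q ((j - 1) * l + i))"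
proof (intro iffI ballI)
  fix n assume "\<forall>i\<in>{1..l}. \<forall>j\<in>{1..k}. Q ((j - 1) * l + i)" and "n \<in> {1..k * l}"
  then have "Q ((Suc ((n - 1) div l) - 1) * l + Suc ((n - 1) mod l))"
    using block_coordinates(1,2) by blast
  then show "Q n"
    unfolding block_coordinates(3)[OF \<open>n \<in> {1..k * l}\<close>] .
qed (use block_index(1) in blast)

lemma map_blocks:
  "map f [1..<Suc (k * l)] = concat (map (\<lambda>j. map (\<lambda>i. f ((j - 1) * l + i)) [1..<Suc l]) [1..<Suc k])"
proof (induct k)
  case (Suc k)
  have "[1..<Suc (Suc k * l)] = [1..<Suc (k * l)] @ [Suc (k * l)..<Suc (k * l) + l]"
    using upt_add_eq_append[of 1 "Suc (k * l)" l] by (simp add: add.commute)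
  also have "[Suc (k * l)..<Suc (k * l) + l] = map (\<lambda>i. k * l + i) [1..<Suc l]"
    by (rule nth_equalityI) simp_all
  finally show ?case
    using Suc by (simp add: upt_Suc o_def)
qed simp

context reflection_generated
begin

text \<open>The conjugation undoes the one that the Kreweras-type map introduces into the differences.\<close>

definition flatten_conj :: "(nat \<Rightarrow> 'a) \<Rightarrow> nat \<Rightarrow> nat \<Rightarrow> (nat \<Rightarrow> nat \<Rightarrow> 'a) \<Rightarrow> (nat \<Rightarrow> 'a)" where
  "flatten_conj u k l E = (\<lambda>n\<in>{1..k * l}.
     let i = Suc ((n - 1) mod l); j = Suc ((n - 1) div l) in u j \<otimes> E i j \<otimes> inv (u j))"

lemma flatten_conj_index:
  assumes "i \<in> {1..l}" "j \<in> {1..k}"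
  shows "flatten_conj u k l E ((j - 1) * l + i) = u j \<otimes> E i j \<otimes> inv (u j)"
  unfolding flatten_conj_def restrict_apply'[OF block_index(1)[OF assms]] Let_def
    block_index(2,3)[OF assms] ..

lemma bij_betw_flatten_conj:
  assumes u: "u \<in> {1..k} \<rightarrow>\<^sub>E carrier G"
  shows "bij_betw (flatten_conj u k l)
    ({1..l} \<rightarrow>\<^sub>E carrier (power_group G k)) ({1..k * l} \<rightarrow>\<^sub>E carrier G)"
proof (rule bij_betw_byWitness[where f' = "\<lambda>e. \<lambda>i\<in>{1..l}. \<lambda>j\<in>{1..k}.
      inv (u j) \<otimes> e ((j - 1) * l + i) \<otimes> u j"])
  let ?f = "flatten_conj u k l"
  let ?g = "\<lambda>e. \<lambda>i\<in>{1..l}. \<lambda>j\<in>{1..k}. inv (u j) \<otimes> e ((j - 1) * l + i) \<otimes> u j"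
  have uj [simp]: "u j \<in> carrier G" if "j \<in> {1..k}" for j
    using u that by auto
  show "\<forall>E\<in>{1..l} \<rightarrow>\<^sub>E carrier (power_group G k). ?g (?f E) = E"
  proof
    fix E assume E: "E \<in> {1..l} \<rightarrow>\<^sub>E carrier (power_group G k)"
    show "?g (?f E) = E"
    proof (rule PiE_ext)
      show "?g (?f E) \<in> {1..l} \<rightarrow>\<^sub>E extensional {1..k}" by auto
      show "E \<in> {1..l} \<rightarrow>\<^sub>E extensional {1..k}" using E by (auto simp: PiE_iff)
      fix i assume i: "i \<in> {1..l}"
      show "?g (?f E) i = E i"
      proof
        fix j
        show "?g (?f E) i j = E i j"
        proof (cases "j \<in> {1..k}")
          case True
          then have "E i j \<in> carrier G" using E i by (auto simp: PiE_iff)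
          then show ?thesis
            using True i by (simp only: restrict_apply' flatten_conj_index) (simp add: m_assoc)
        next
          case False
          then show ?thesis using E i by (auto simp: PiE_iff extensional_def)
        qed
      qed
    qed
  qed
  show "\<forall>e\<in>{1..k * l} \<rightarrow>\<^sub>E carrier G. ?f (?g e) = e"
  proof
    fix e assume e: "e \<in> {1..k * l} \<rightarrow>\<^sub>E carrier G"
    show "?f (?g e) = e"
    proof (rule PiE_ext)
      show "?f (?g e) \<in> {1..k * l} \<rightarrow>\<^sub>E UNIV" by (simp add: flatten_conj_def)
      show "e \<in> {1..k * l} \<rightarrow>\<^sub>E UNIV" using e by (auto simp: PiE_iff)
      fix n assume n: "n \<in> {1..k * l}"
      have "\<forall>n\<in>{1..k * l}. ?f (?g e) n = e n"
        unfolding ball_flatten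
      proof (intro ballI)
        fix i j assume ij: "i \<in> {1..l}" "j \<in> {1..k}"
        then have "e ((j - 1) * l + i) \<in> carrier G"
          using e block_index(1) by blast
        then show "?f (?g e) ((j - 1) * l + i) = e ((j - 1) * l + i)"
          using ij by (simp only: restrict_apply' flatten_conj_index) (simp add: m_assoc)
      qed
      then show "?f (?g e) n = e n" using n by blast
    qed
  qed
  show "?f ` ({1..l} \<rightarrow>\<^sub>E carrier (power_group G k)) \<subseteq> {1..k * l} \<rightarrow>\<^sub>E carrier G"
  proof
    fix e assume "e \<in> ?f ` ({1..l} \<rightarrow>\<^sub>E carrier (power_group G k))"
    then obtain E where E: "E \<in> {1..l} \<rightarrow>\<^sub>E carrier (power_group G k)" and e: "e = ?f E"
      by blast
    have "\<forall>n\<in>{1..k * l}. e n \<in> carrier G"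
      unfolding ball_flatten e using E by (auto simp: flatten_conj_index PiE_iff)
    then show "e \<in> {1..k * l} \<rightarrow>\<^sub>E carrier G"
      by (auto simp: PiE_iff e flatten_conj_def)
  qed
  show "?g ` ({1..k * l} \<rightarrow>\<^sub>E carrier G) \<subseteq> {1..l} \<rightarrow>\<^sub>E carrier (power_group G k)"
  proof
    fix E assume "E \<in> ?g ` ({1..k * l} \<rightarrow>\<^sub>E carrier G)"
    then obtain e where e: "e \<in> {1..k * l} \<rightarrow>\<^sub>E carrier G" and E: "E = ?g e"
      by blast
    have "inv (u j) \<otimes> e ((j - 1) * l + i) \<otimes> u j \<in> carrier G"
      if "i \<in> {1..l}" "j \<in> {1..k}" for i j
      using that e block_index(1)[OF that] by (auto simp only: PiE_iff uj m_closed inv_closed)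
    then show "E \<in> {1..l} \<rightarrow>\<^sub>E carrier (power_group G k)"
      unfolding E carrier_product_group restrict_PiE_iff by blast
  qed
qed

text \<open>
  The \<open>i\<close>-th entry of a multichain with tail product \<open>t\<close> of its differences is \<open>c t\<^sup>-\<^sup>1\<close>; solving
  \<open>c t\<^sup>-\<^sup>1 = \<Psi> d\<close> for \<open>d\<close> shows which tuple is embedded there, and that conjugation by \<open>g\<^sup>-\<^sup>1 c\<close> is the one to
  use when flattening.
\<close>

lemma partial_quotient_eq_conj_iff:
  assumes [simp]: "g \<in> carrier G" "c \<in> carrier G" "d \<in> carrier G" "t \<in> carrier G"
  shows "c \<otimes> inv t = g \<otimes> inv d \<otimes> inv g \<otimes> c \<longleftrightarrow> d = (inv g \<otimes> c) \<otimes> t \<otimes> inv (inv g \<otimes> c)"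
proof
  assume *: "c \<otimes> inv t = g \<otimes> inv d \<otimes> inv g \<otimes> c"
  have "t = inv (inv c \<otimes> (c \<otimes> inv t))" by simp
  also have "\<dots> = inv c \<otimes> g \<otimes> d \<otimes> inv g \<otimes> c"
    unfolding * by (simp add: inv_mult_group m_assoc)
  finally show "d = (inv g \<otimes> c) \<otimes> t \<otimes> inv (inv g \<otimes> c)"
    by (simp add: inv_mult_group m_assoc)
qed (simp add: inv_mult_group m_assoc)

text \<open>
  Here \<open>E\<close> is a candidate for the differences of an \<open>l\<close>-multichain in the power group. The
  columns of the conjugated matrix decide whether it comes from a multichain at all,
  and the tail products of its columns are the tuples whose images under \<open>\<Psi>\<close> are the entries of that multichain.
\<close>

lemma flatten_conj_factor_tuples_iff:
  assumes c: "c \<in> carrier G" and "1 \<le> l"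
    and g: "g \<in> carrier (power_group G k)"
    and comm: "g \<otimes>\<^bsub>power_group G k\<^esub> power_elt c k = power_elt c k \<otimes>\<^bsub>power_group G k\<^esub> g"
    and \<Psi>: "\<And>w. w \<in> NC (power_group G k) (power_gens G S k) (power_elt c k) \<Longrightarrow>
      \<Psi> w = g \<otimes>\<^bsub>power_group G k\<^esub> inv\<^bsub>power_group G k\<^esub> w \<otimes>\<^bsub>power_group G k\<^esub>
        inv\<^bsub>power_group G k\<^esub> g \<otimes>\<^bsub>power_group G k\<^esub> power_elt c k"
    and E: "E \<in> {1..l} \<rightarrow>\<^sub>E carrier (power_group G k)"
    and u_def: "u = inv\<^bsub>power_group G k\<^esub> g \<otimes>\<^bsub>power_group G k\<^esub> power_elt c k"
  shows "flatten_conj u k l E \<in> factor_tuples c (k * l) \<longleftrightarrow>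
    E \<in> reflection_generated.factor_tuples (power_group G k) (power_gens G S k) (power_elt c k) l \<and>
    (\<forall>i\<in>{1..l}. reflection_generated.partial_quotients (power_group G k) (power_elt c k) l E i
       \<in> \<Psi> ` factor_tuples c k)"
proof -
  interpret P: reflection_generated "power_group G k" "power_gens G S k"
    by (rule power_reflection_generated)
  note [simp del] = carrier_product_group
  define C where "C = power_elt c k"
  define x where "x i j = u j \<otimes> E i j \<otimes> inv (u j)" for i j
  define T where "T i = word_val (power_group G k) (map E [i..<Suc l])" for i
  define D where "D i = u \<otimes>\<^bsub>power_group G k\<^esub> T i \<otimes>\<^bsub>power_group G k\<^esub> inv\<^bsub>power_group G k\<^esub> u" for i
  have C: "C \<in> carrier (power_group G k)"
    using power_elt_closed[OF c] by (simp add: C_def)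
  have u: "u \<in> carrier (power_group G k)"
    using g C unfolding u_def C_def by blast
  then have u': "u \<in> {1..k} \<rightarrow>\<^sub>E carrier G"
    by (simp add: carrier_product_group)
  then have uj [simp]: "u j \<in> carrier G" if "j \<in> {1..k}" for j
    using that by auto
  have Eij [simp]: "E i j \<in> carrier G" if "i \<in> {1..l}" "j \<in> {1..k}" for i j
    using E that by (auto simp: PiE_iff carrier_product_group)
  have g': "g \<in> {1..k} \<rightarrow>\<^sub>E carrier G"
    using g by (simp add: carrier_product_group)
  \<comment> \<open>Since \<open>u\<close> commutes with \<open>c\<close>, conjugating by it preserves the condition of lying below \<open>c\<close>.\<close>
  have uc: "u j \<otimes> c \<otimes> inv (u j) = c" if j: "j \<in> {1..k}" for j
  proof -
    have gj: "g j \<in> carrier G" using g' j by auto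
    have "g j \<otimes> c = c \<otimes> g j"
      using fun_cong[OF comm, of j] j by (simp add: power_elt_def)
    then have "c \<otimes> g j = g j \<otimes> c" ..
    moreover have "u j = inv (g j) \<otimes> c"
      using j g' by (simp add: u_def power_elt_def)
    ultimately show ?thesis
      using c gj by (simp add: inv_mult_group m_assoc)
  qed
  have set_tail: "set (map E [i..<Suc l]) \<subseteq> carrier (power_group G k)" if "1 \<le> i" for i
    using E that by (auto simp: PiE_iff)
  then have T: "T i \<in> carrier (power_group G k)" if "1 \<le> i" for i
    using that unfolding T_def by (intro P.word_val_closed)
  have x_map: "map (\<lambda>i. x i j) [i..<Suc l] =
      map (\<lambda>y. u j \<otimes> y \<otimes> inv (u j)) (map (\<lambda>i. E i j) [i..<Suc l])" for i j
    by (simp add: x_def)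
  have set_col: "set (map (\<lambda>i. E i j) [i..<Suc l]) \<subseteq> carrier G" if "1 \<le> i" "j \<in> {1..k}" for i j
    using that by auto
  have D: "D i = (\<lambda>j\<in>{1..k}. word_val G (map (\<lambda>i. x i j) [i..<Suc l]))" if i: "1 \<le> i" for i
  proof
    fix j
    show "D i j = (\<lambda>j\<in>{1..k}. word_val G (map (\<lambda>i. x i j) [i..<Suc l])) j"
    proof (cases "j \<in> {1..k}")
      case True
      then have "T i j = word_val G (map (\<lambda>i. E i j) [i..<Suc l])"
        unfolding T_def using word_val_power[OF True set_tail[OF i]] by (simp add: o_def)
      moreover have "word_val G (map (\<lambda>i. x i j) [i..<Suc l]) =
          u j \<otimes> word_val G (map (\<lambda>i. E i j) [i..<Suc l]) \<otimes> inv (u j)"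
        unfolding x_map by (rule word_val_conj[OF uj[OF True] set_col[OF i True]])
      ultimately show ?thesis
        using True u' by (simp add: D_def)
    qed (auto simp: D_def)
  qed
  have D_closed: "D i \<in> carrier (power_group G k)" if "1 \<le> i" for i
    using T[OF that] u unfolding D_def by blast
  have columns: "reduced_below c (map (\<lambda>i. x i j) [1..<Suc l]) \<longleftrightarrow>
      reduced_below c (map (\<lambda>i. E i j) [1..<Suc l])" if j: "j \<in> {1..k}" for j
  proof -
    have "word_val G (map (\<lambda>i. E i j) [1..<Suc l]) \<in> carrier G"
      using set_col[OF _ j] by (intro word_val_closed) simp
    then have "u j \<otimes> word_val G (map (\<lambda>i. E i j) [1..<Suc l]) \<otimes> inv (u j) \<preceq> c \<longleftrightarrow>
        word_val G (map (\<lambda>i. E i j) [1..<Suc l]) \<preceq> c"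
      using le_conj_iff[of _ c "u j"] c j by (simp add: uc)
    then show ?thesis
      unfolding x_map reduced_below_def using j set_col[OF _ j]
      by (simp add: word_val_conj reduced_conj_iff del: map_map set_map)
  qed
  have "E \<in> P.factor_tuples C l \<longleftrightarrow> P.reduced_below C (map E [1..<Suc l])"
    using E by (simp add: P.factor_tuples_def)
  also have "\<dots> \<longleftrightarrow> (\<forall>j\<in>{1..k}. reduced_below c (map (\<lambda>i. E i j) [1..<Suc l]))"
    unfolding C_def using power_reduced_below_iff[OF c set_tail] by (simp add: o_def)
  finally have tuples: "E \<in> P.factor_tuples C l \<longleftrightarrow>
      (\<forall>j\<in>{1..k}. reduced_below c (map (\<lambda>i. x i j) [1..<Suc l]))"
    using columns by simp
  have quotients: "P.partial_quotients C l E i \<in> \<Psi> ` factor_tuples c k \<longleftrightarrow> D i \<in> factor_tuples c k"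
    if i: "i \<in> {1..l}" for i
  proof -
    have \<Psi>_eq: "P.partial_quotients C l E i = \<Psi> d \<longleftrightarrow> d = D i" if d: "d \<in> factor_tuples c k" for d
    proof -
      have "d \<in> {1..k} \<rightarrow>\<^sub>E NC G S c"
        using d factor_tuple_NC[OF c d] by (auto simp: factor_tuples_def PiE_iff)
      then have dNC: "d \<in> NC (power_group G k) (power_gens G S k) C"
        using power_NC_iff[OF c] by (simp add: C_def)
      then have "d \<in> carrier (power_group G k)"
        by (simp add: P.NC_iff)
      then show ?thesis
        using P.partial_quotient_eq_conj_iff[OF g C _ T[of i], of d] i \<Psi>[of d] dNC
        by (simp add: P.partial_quotients_def T_def D_def u_def C_def)
    qed
    then show ?thesis by auto
  qed
  have "flatten_conj u k l E \<in> factor_tuples c (k * l) \<longleftrightarrow>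
      reduced_below c (map (flatten_conj u k l E) [1..<Suc (k * l)])"
    using bij_betw_apply[OF bij_betw_flatten_conj[OF u'] E] by (simp add: factor_tuples_def)
  also have "map (flatten_conj u k l E) [1..<Suc (k * l)] =
      concat (map (\<lambda>j. map (\<lambda>i. x i j) [1..<Suc l]) [1..<Suc k])"
    unfolding map_blocks
    by (intro arg_cong[of _ _ concat] map_cong) (auto simp: flatten_conj_index x_def)
  also have "reduced_below c \<dots> \<longleftrightarrow>
      (\<forall>j\<in>{1..k}. reduced_below c (map (\<lambda>i. x i j) [1..<Suc l])) \<and>
      (\<forall>i\<in>{1..l}. D i \<in> factor_tuples c k)"
    using reduced_below_matrix_iff[OF c \<open>1 \<le> l\<close>, of k x] D by (simp add: x_def)
  finally show ?thesis
    using tuples quotients by (simp add: C_def)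
qed


end


section \<open>The isomorphism\<close>

lemma poset_iso_via:
  assumes \<phi>: "bij_betw \<phi> (carrier P) D"
    "\<And>x y. x \<in> carrier P \<Longrightarrow> y \<in> carrier P \<Longrightarrow> x \<sqsubseteq>\<^bsub>P\<^esub> y \<longleftrightarrow> R (\<phi> x) (\<phi> y)"
    and \<psi>: "bij_betw \<psi> (carrier Q) D"
    "\<And>x y. x \<in> carrier Q \<Longrightarrow> y \<in> carrier Q \<Longrightarrow> x \<sqsubseteq>\<^bsub>Q\<^esub> y \<longleftrightarrow> R (\<psi> x) (\<psi> y)"
  shows "poset_iso P Q"
proof -
  define \<theta> where "\<theta> x = inv_into (carrier Q) \<psi> (\<phi> x)" for x
  have \<theta>: "bij_betw \<theta> (carrier P) (carrier Q)"
    using bij_betw_trans[OF \<phi>(1) bij_betw_inv_into[OF \<psi>(1)]] by (simp add: \<theta>_def[abs_def] o_def)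
  have "\<psi> (\<theta> x) = \<phi> x" if "x \<in> carrier P" for x
    using that \<phi>(1) \<psi>(1) unfolding \<theta>_def by (intro f_inv_into_f) (auto simp: bij_betw_def)
  then have "x \<sqsubseteq>\<^bsub>P\<^esub> y \<longleftrightarrow> \<theta> x \<sqsubseteq>\<^bsub>Q\<^esub> \<theta> y" if "x \<in> carrier P" "y \<in> carrier P" for x y
    using \<phi>(2)[OF that] \<psi>(2)[of "\<theta> x" "\<theta> y"] that bij_betw_apply[OF \<theta>] by simp
  then show ?thesis
    using \<theta> unfolding poset_iso_def by blast
qed

context reflection_generated
begin

text \<open>
  Coordinates for the iterated poset: take differences in the power group, then flatten. They live
  in the same set as the differences of the \<open>k l\<close>-multichains and carry the same order.
\<close>

lemma NCk_iter_factor_tuples: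
  assumes c: "c \<in> carrier G" and l: "1 \<le> l"
    and \<Psi>: "kreweras_type (power_group G k) (power_gens G S k) (power_elt c k) \<Psi>"
  obtains \<phi> where
    "bij_betw \<phi> (carrier (NCk_iter G S c k \<Psi> l)) (factor_tuples c (k * l))"
    "\<And>p q. p \<in> carrier (NCk_iter G S c k \<Psi> l) \<Longrightarrow> q \<in> carrier (NCk_iter G S c k \<Psi> l) \<Longrightarrow>
       p \<sqsubseteq>\<^bsub>NCk_iter G S c k \<Psi> l\<^esub> q \<longleftrightarrow> (\<forall>n\<in>{1..k * l}. \<phi> q n \<preceq> \<phi> p n)"
proof -
  interpret P: reflection_generated "power_group G k" "power_gens G S k"
    by (rule power_reflection_generated)
  note [simp del] = carrier_product_group
  let ?I = "NCk_iter G S c k \<Psi> l"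
  define C where "C = power_elt c k"
  have C: "C \<in> carrier (power_group G k)"
    using power_elt_closed[OF c] by (simp add: C_def)
  obtain g where g: "g \<in> carrier (power_group G k)"
    "g \<otimes>\<^bsub>power_group G k\<^esub> C = C \<otimes>\<^bsub>power_group G k\<^esub> g"
    "\<And>w. w \<in> NC (power_group G k) (power_gens G S k) C \<Longrightarrow>
      \<Psi> w = g \<otimes>\<^bsub>power_group G k\<^esub> inv\<^bsub>power_group G k\<^esub> w \<otimes>\<^bsub>power_group G k\<^esub>
        inv\<^bsub>power_group G k\<^esub> g \<otimes>\<^bsub>power_group G k\<^esub> C"
    using P.kreweras_type_conjugation[OF C, of \<Psi>] \<Psi> unfolding C_def by metis
  define u where "u = inv\<^bsub>power_group G k\<^esub> g \<otimes>\<^bsub>power_group G k\<^esub> C"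
  have u: "u \<in> carrier (power_group G k)"
    using g C unfolding u_def by blast
  then have u': "u \<in> {1..k} \<rightarrow>\<^sub>E carrier G"
    by (simp add: carrier_product_group)
  let ?tuples = "{1..l} \<rightarrow>\<^sub>E carrier (power_group G k)"
  define diffs where "diffs = {E \<in> P.factor_tuples C l.
      \<forall>i\<in>{1..l}. P.partial_quotients C l E i \<in> \<Psi> ` factor_tuples c k}"
  have diffs_sub: "diffs \<subseteq> ?tuples"
    by (auto simp: diffs_def P.factor_tuples_def)
  have image: "NCk_image G S c k \<Psi> = \<Psi> ` factor_tuples c k"
    using bij_betw_delta[OF c, of k] unfolding NCk_image_def NCk_def image_comp[symmetric]
    by (simp add: bij_betw_def)
  have carrier: "carrier ?I =
      {p \<in> NC_multichains (power_group G k) (power_gens G S k) C l. \<forall>i\<in>{1..l}. p i \<in> \<Psi> ` factor_tuples c k}"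
    by (simp add: NCk_iter_def NCk_def C_def image)
  have multichains: "p \<in> ?tuples"
    if "p \<in> NC_multichains (power_group G k) (power_gens G S k) C l" for p
    using that P.NC_multichains_iff[OF C] by blast
  have delta_diffs: "bij_betw (delta (power_group G k) C l) (carrier ?I) diffs"
  proof (rule bij_betw_subset[OF P.bij_betw_delta[OF C]])
    show "carrier ?I \<subseteq> NC_multichains (power_group G k) (power_gens G S k) C l"
      by (auto simp: carrier)
    have diffs_iff: "delta (power_group G k) C l p \<in> diffs \<longleftrightarrow> p \<in> carrier ?I"
      if "p \<in> NC_multichains (power_group G k) (power_gens G S k) C l" for p
      using that P.partial_quotients_delta[OF C multichains[OF that]]
        P.delta_in_factor_tuples_iff[OF C multichains[OF that]]
      by (simp add: diffs_def carrier)
    have "diffs \<subseteq> delta (power_group G k) C l ` NC_multichains (power_group G k) (power_gens G S k) C l"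
      using P.bij_betw_delta[OF C, of l] by (auto simp: bij_betw_def diffs_def)
    then show "delta (power_group G k) C l ` carrier ?I = diffs"
      using diffs_iff \<open>carrier ?I \<subseteq> _\<close> by blast
  qed
  have flat_diffs: "bij_betw (flatten_conj u k l) diffs (factor_tuples c (k * l))"
  proof (rule bij_betw_subset[OF bij_betw_flatten_conj[OF u'] diffs_sub])
    have iff: "flatten_conj u k l E \<in> factor_tuples c (k * l) \<longleftrightarrow> E \<in> diffs" if "E \<in> ?tuples" for E
      using flatten_conj_factor_tuples_iff[OF c l g(1) _ _ that, of \<Psi> u] g(2,3) u_def
      by (simp add: diffs_def C_def)
    have "factor_tuples c (k * l) \<subseteq> flatten_conj u k l ` ?tuples"
      using bij_betw_flatten_conj[OF u', of l] by (auto simp: bij_betw_def factor_tuples_def)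
    then show "flatten_conj u k l ` diffs = factor_tuples c (k * l)"
      using iff diffs_sub by blast
  qed
  have order: "p \<sqsubseteq>\<^bsub>?I\<^esub> q \<longleftrightarrow> (\<forall>n\<in>{1..k * l}.
      flatten_conj u k l (delta (power_group G k) C l q) n \<preceq>
      flatten_conj u k l (delta (power_group G k) C l p) n)"
    if pq: "p \<in> carrier ?I" "q \<in> carrier ?I" for p q
  proof -
    define A where "A = delta (power_group G k) C l q"
    define B where "B = delta (power_group G k) C l p"
    have AB: "A \<in> ?tuples" "B \<in> ?tuples"
      using pq bij_betw_apply[OF delta_diffs] diffs_sub unfolding A_def B_def by blast+
    then have entries: "A i \<in> carrier (power_group G k)" "B i \<in> carrier (power_group G k)"
      if "i \<in> {1..l}" for i
      using that by auto
    then have entries': "A i j \<in> carrier G" "B i j \<in> carrier G"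
      if "i \<in> {1..l}" "j \<in> {1..k}" for i j
      using that by (auto simp: carrier_product_group PiE_iff)
    have "p \<sqsubseteq>\<^bsub>?I\<^esub> q \<longleftrightarrow> (\<forall>i\<in>{1..l}. P.le_T (A i) (B i))"
      by (simp add: NCk_iter_def NCk_def A_def B_def C_def)
    also have "\<dots> \<longleftrightarrow> (\<forall>i\<in>{1..l}. \<forall>j\<in>{1..k}. A i j \<preceq> B i j)"
      using entries power_le_iff by simp
    also have "\<dots> \<longleftrightarrow> (\<forall>i\<in>{1..l}. \<forall>j\<in>{1..k}.
        u j \<otimes> A i j \<otimes> inv (u j) \<preceq> u j \<otimes> B i j \<otimes> inv (u j))"
      using entries' u' by (intro ball_cong refl) (auto simp: le_conj_iff PiE_iff)
    also have "\<dots> \<longleftrightarrow> (\<forall>n\<in>{1..k * l}. flatten_conj u k l A n \<preceq> flatten_conj u k l B n)"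
      unfolding ball_flatten by (intro ball_cong refl) (simp only: flatten_conj_index)
    finally show ?thesis by (simp add: A_def B_def)
  qed
  show ?thesis
    using that[OF bij_betw_trans[OF delta_diffs flat_diffs]] order by simp
qed

lemma NCk_iter_iso_NCk:
  assumes c: "c \<in> carrier G" and l: "1 \<le> l"
    and \<Psi>: "kreweras_type (power_group G k) (power_gens G S k) (power_elt c k) \<Psi>"
  shows "poset_iso (NCk_iter G S c k \<Psi> l) (NCk G S c (k * l))"
    and "poset_iso (NCk G S c (k * l)) (NCk_iter G S c k \<Psi> l)"
proof -
  let ?R = "\<lambda>d e. \<forall>n\<in>{1..k * l}. e n \<preceq> d n"
  obtain \<phi> where \<phi>: "bij_betw \<phi> (carrier (NCk_iter G S c k \<Psi> l)) (factor_tuples c (k * l))"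
    "\<And>p q. p \<in> carrier (NCk_iter G S c k \<Psi> l) \<Longrightarrow> q \<in> carrier (NCk_iter G S c k \<Psi> l) \<Longrightarrow>
       p \<sqsubseteq>\<^bsub>NCk_iter G S c k \<Psi> l\<^esub> q \<longleftrightarrow> ?R (\<phi> p) (\<phi> q)"
    using NCk_iter_factor_tuples[OF c l \<Psi>] by blast
  have \<psi>: "bij_betw (delta G c (k * l)) (carrier (NCk G S c (k * l))) (factor_tuples c (k * l))"
    "\<And>p q. p \<sqsubseteq>\<^bsub>NCk G S c (k * l)\<^esub> q \<longleftrightarrow> ?R (delta G c (k * l) p) (delta G c (k * l) q)"
    using bij_betw_delta[OF c] by (simp_all add: NCk_def)
  show "poset_iso (NCk_iter G S c k \<Psi> l) (NCk G S c (k * l))"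
    by (rule poset_iso_via[where R = ?R, OF \<phi> \<psi>])
  show "poset_iso (NCk G S c (k * l)) (NCk_iter G S c k \<Psi> l)"
    by (rule poset_iso_via[where R = ?R, OF \<psi> \<phi>])
qed

end

text \<open>
  Simple generators are reflections and involutions, so the inverses allowed in \<^const>\<open>generate\<close>
  add nothing to the words in reflections.
\<close>

lemma coxeter_system_reflection_generated:
  assumes "coxeter_system W S"
  shows "reflection_generated W S"
proof -
  interpret group W using assms by (simp add: coxeter_system_def)
  have S: "S \<subseteq> carrier W" "generate W S = carrier W" "\<And>s. s \<in> S \<Longrightarrow> ord s = 2"
    using assms by (auto simp: coxeter_system_def)
  have simple: "s \<in> reflections W S" if "s \<in> S" for s
  proof -
    have "s = \<one>\<^bsub>W\<^esub> \<otimes>\<^bsub>W\<^esub> s \<otimes>\<^bsub>W\<^esub> inv\<^bsub>W\<^esub> \<one>\<^bsub>W\<^esub>" using that S by auto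
    then show ?thesis unfolding reflections_def using that by blast
  qed
  have inv_s: "inv\<^bsub>W\<^esub> s = s" if "s \<in> S" for s
  proof -
    have "s [^]\<^bsub>W\<^esub> (2::nat) = \<one>\<^bsub>W\<^esub>"
      using pow_ord_eq_1[of s] S that by auto
    then have "s \<otimes>\<^bsub>W\<^esub> s = \<one>\<^bsub>W\<^esub>"
      using S that by (auto simp: numeral_2_eq_2)
    then show ?thesis using S that by (meson inv_equality subsetD)
  qed
  have T: "reflections W S \<subseteq> carrier W"
    using S by (auto simp: reflections_def)
  have "\<exists>ts\<in>lists (reflections W S). word_val W ts = w" if "w \<in> generate W S" for w
    using that
  proof (induct rule: generate.induct)
    case one
    show ?case by (intro bexI[of _ "[]"]) auto
  next
    case (incl s)
    then show ?case using simple S by (intro bexI[of _ "[s]"]) auto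
  next
    case (inv s)
    then show ?case using simple S inv_s by (intro bexI[of _ "[s]"]) auto
  next
    case (eng x y)
    then obtain xs ys where xy: "xs \<in> lists (reflections W S)" "word_val W xs = x"
      "ys \<in> lists (reflections W S)" "word_val W ys = y" by blast
    then have "set xs \<subseteq> carrier W" "set ys \<subseteq> carrier W" using T by auto
    then show ?case using xy by (intro bexI[of _ "xs @ ys"]) (auto simp: word_val_append)
  qed
  then show ?thesis
    using S by unfold_locales auto
qed

theorem theorem3p6p7:
  fixes W :: "('a, 'm) monoid_scheme" and S :: "'a set" and c :: 'a and k l :: nat
    and \<Psi> \<Phi> :: "(nat \<Rightarrow> 'a) \<Rightarrow> (nat \<Rightarrow> 'a)"
  assumes "finite_coxeter_system W S"
    and "coxeter_element W S c"
    and "1 \<le> k" and "1 \<le> l"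
    and "kreweras_type (power_group W k) (power_gens W S k) (power_elt c k) \<Psi>"
    and "kreweras_type (power_group W l) (power_gens W S l) (power_elt c l) \<Phi>"
  shows "poset_iso (NCk_iter W S c k \<Psi> l) (NCk W S c (k * l)) \<and>
         poset_iso (NCk W S c (k * l)) (NCk_iter W S c l \<Phi> k)"
proof -
  interpret reflection_generated W S
    using assms(1) by (intro coxeter_system_reflection_generated) (simp add: finite_coxeter_system_def)
  have "c \<in> carrier W"
    using assms(2) gens_closed by (auto simp: coxeter_element_def)
  then show ?thesis
    using NCk_iter_iso_NCk(1)[of c l k \<Psi>] NCk_iter_iso_NCk(2)[of c k l \<Phi>] assms(3-)
    by (simp add: mult.commute)
qed

end
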